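(* Let $n\ge1$ be an integer and $0<m<1$. Assume $V\in W^{2,\infty}_{loc}(\mathbb R^n)$ is radially symmetric, strictly increasing in $|x|$, $V\ge0$, $V(0)=0$, $\int_{B_1}\rho_V^{1+\varepsilon_0}\,dx<\infty$ for some $\varepsilon_0>0$, and that there are $C_V>0$ and $R_V>0$ with $$\frac{\partial V}{\partial r}(r)\le C_V\,r\qquad\text{for }0<r<R_V .$$ Let $0\le\rho_0\in L^1(\mathbb R^n)$ be radially symmetric, non-increasing in $|x|$, with $\|\rho_0\|_{L^1(\mathbb R^n)}=1$. Let $M$ be a viscosity mass solution with initial datum $M(0,v)=\int_{\widetilde B_v}\rho_0\,dx$ constructed as a limit of the problems in balls (see context). Then $M$ does not concentrate in finite time, i.e. $M(t,0)=\lim_{v\to0^+}M(t,v)=0$ for every $t>0$.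
   Context: $B_r$ is the open ball of radius $r$ centred at $0$ in $\mathbb R^n$, $\omega_n=|B_1|$, $\widetilde B_v$ is the ball centred at $0$ of volume $v$, $R_v=\omega_nR^n$. $\rho_V(x)=\left(\tfrac{1-m}{m}V(x)\right)^{-\frac1{1-m}}$. Radial functions are regarded also as functions of $r=|x|$. Construction of $M$: for $R>1$ let $V_R\in W^{2,\infty}(B_R)$ be radially symmetric, strictly increasing, $0\le V_R\le V$, $V_R=V$ for $|x|\le R-1$, $\nabla V_R\cdot x=0$ on $\partial B_R$. Consider $\partial_t\rho=\Delta\rho^m+\nabla\cdot(\rho\nabla V_R)$ in $(0,\infty)\times B_R$ with $(\nabla\rho^m+\rho\nabla V_R)\cdot x=0$ on $\partial B_R$. A weak $L^1$ solution on $(0,T)$ with datum $\rho_0$ is $0\le\rho\in L^1((0,T)\times B_R)$ with $\rho^m\in L^1(0,T;W^{1,1}(B_R))$ such that for every $\varphi\in L^\infty(0,T;W^{2,\infty}(B_R))\cap C^1([0,T];L^\infty(B_R))$ and a.e. $t\in(0,T)$, $\int_{B_R}\rho(t)\varphi(t)-\int_0^t\int_{B_R}\rho\varphi_t=-\int_0^t\int_{B_R}(\nabla\rho^m\cdot\nabla\varphi+\rho\nabla V_R\cdot\nabla\varphi)+\int_{B_R}\rho_0\varphi(0)$. For $\rho_0\in H^1(B_R)$ with $0<\varepsilon\le\rho_0\le\varepsilon^{-1}$, $S_R(t)\rho_0$ is the unique weak $L^1$ solution that for every $T$ lies in $H^1((0,T)\times B_R)$ and is bounded below by a positive constant on $(0,T)\times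 B_R$; $S_R(t)$ is an $L^1$-contraction on such data and is extended uniquely by continuity to all nonnegative functions in $L^1(B_R)$. Set $\widetilde M_R(t,v)=\int_{\widetilde B_v}S_R(t)[\rho_0|_{B_R}]\,dx$ for $v\le R_v$ and $\widetilde M_R(t,v)=\|\rho_0\|_{L^1(B_R)}$ for $v>R_v$. For suitable sequences $R_k\to\infty$, $\widetilde M_{R_k}$ converges locally uniformly on $[0,\infty)\times(0,\infty)$; the limit $M$ is the viscosity mass solution (it is a viscosity solution in $(0,\infty)^2$ of $\partial_tM=(n\omega_n^{1/n}v^{(n-1)/n})^2\{\partial_v[(\partial_vM)^m]+\partial_vM\,\partial_vV\}$). *)

theory Defs
  imports "HOL-Analysis.Analysis"
begin

section \<open>Weak derivatives and Sobolev spaces\<close>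

primrec Ck :: "nat \<Rightarrow> ('b::euclidean_space \<Rightarrow> real) \<Rightarrow> bool" where
  "Ck 0 f \<longleftrightarrow> continuous_on UNIV f"
| "Ck (Suc k) f \<longleftrightarrow> (\<forall>x. f differentiable (at x)) \<and>
     (\<forall>b\<in>Basis. Ck k (\<lambda>x. frechet_derivative f (at x) b))"

definition test_function :: "'b::euclidean_space set \<Rightarrow> ('b \<Rightarrow> real) \<Rightarrow> bool" where
  "test_function \<Omega> f \<longleftrightarrow> (\<forall>k. Ck k f) \<and> compact (closure {x. f x \<noteq> 0}) \<and> closure {x. f x \<noteq> 0} \<subseteq> \<Omega>"

definition locally_integrable :: "'b::euclidean_space set \<Rightarrow> ('b \<Rightarrow> real) \<Rightarrow> bool" where
  "locally_integrable \<Omega> f \<longleftrightarrow> (\<forall>K. compact K \<and> K \<subseteq> \<Omega> \<longrightarrow> integrable (lebesgue_on K) f)"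

definition weak_partial ::
  "'b::euclidean_space set \<Rightarrow> 'b \<Rightarrow> ('b \<Rightarrow> real) \<Rightarrow> ('b \<Rightarrow> real) \<Rightarrow> bool" where
  "weak_partial \<Omega> b f g \<longleftrightarrow> locally_integrable \<Omega> f \<and> locally_integrable \<Omega> g \<and>
     (\<forall>\<eta>. test_function \<Omega> \<eta> \<longrightarrow>
        (LINT x|lebesgue_on \<Omega>. f x * frechet_derivative \<eta> (at x) b) = - (LINT x|lebesgue_on \<Omega>. g x * \<eta> x))"

definition weak_gradient ::
  "'b::euclidean_space set \<Rightarrow> ('b \<Rightarrow> real) \<Rightarrow> ('b \<Rightarrow> 'b) \<Rightarrow> bool" where
  "weak_gradient \<Omega> f G \<longleftrightarrow> (\<forall>b\<in>Basis. weak_partial \<Omega> b f (\<lambda>x. G x \<bullet> b))"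

definition L2_on :: "'b::euclidean_space set \<Rightarrow> ('b \<Rightarrow> real) \<Rightarrow> bool" where
  "L2_on \<Omega> f \<longleftrightarrow> f \<in> borel_measurable (lebesgue_on \<Omega>) \<and> integrable (lebesgue_on \<Omega>) (\<lambda>x. (f x)\<^sup>2)"

definition Linf_bounded :: "real \<Rightarrow> 'b::euclidean_space set \<Rightarrow> ('b \<Rightarrow> real) \<Rightarrow> bool" where
  "Linf_bounded C \<Omega> f \<longleftrightarrow>
     f \<in> borel_measurable (lebesgue_on \<Omega>) \<and> (AE x in lebesgue_on \<Omega>. \<bar>f x\<bar> \<le> C)"

definition Linf_on :: "'b::euclidean_space set \<Rightarrow> ('b \<Rightarrow> real) \<Rightarrow> bool" where
  "Linf_on \<Omega> f \<longleftrightarrow> (\<exists>C. Linf_bounded C \<Omega> f)"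

text \<open>With \<open>X\<close> the Lebesgue space \<open>L\<^sup>p\<close>, \<open>sobolev k X \<Omega>\<close> is \<open>W\<^bsup>k,p\<^esup>(\<Omega>)\<close>. With
  \<open>X = Linf_bounded C\<close> it says that all weak derivatives of order at most \<open>k\<close> exist and are bounded
  by \<open>C\<close>, i.e. it is the ball of radius \<open>C\<close> in \<open>W\<^bsup>k,\<infinity>\<^esup>(\<Omega>)\<close>.\<close>

primrec sobolev ::
  "nat \<Rightarrow> ('b::euclidean_space set \<Rightarrow> ('b \<Rightarrow> real) \<Rightarrow> bool) \<Rightarrow> 'b set \<Rightarrow> ('b \<Rightarrow> real) \<Rightarrow> bool" where
  "sobolev 0 X \<Omega> f \<longleftrightarrow> X \<Omega> f"
| "sobolev (Suc k) X \<Omega> f \<longleftrightarrow>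
     X \<Omega> f \<and> (\<forall>b\<in>Basis. \<exists>g. weak_partial \<Omega> b f g \<and> sobolev k X \<Omega> g)"

definition grad :: "('b::euclidean_space \<Rightarrow> real) \<Rightarrow> 'b \<Rightarrow> 'b" where
  "grad f x = (\<Sum>b\<in>Basis. frechet_derivative f (at x) b *\<^sub>R b)"

text \<open>Elements of \<open>W\<^bsup>2,\<infinity>\<^esup>\<close> of a ball have a unique \<open>C\<^sup>1\<close> representative. Potentials are
  represented by it, so that pointwise conditions on them and on their gradients make sense.\<close>

definition C1_on :: "'b::euclidean_space set \<Rightarrow> ('b \<Rightarrow> real) \<Rightarrow> bool" where
  "C1_on \<Omega> f \<longleftrightarrow> (\<forall>x\<in>\<Omega>. f differentiable (at x)) \<and> continuous_on \<Omega> (grad f)"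

definition W2inf :: "'b::euclidean_space set \<Rightarrow> ('b \<Rightarrow> real) \<Rightarrow> bool" where
  "W2inf \<Omega> f \<longleftrightarrow> C1_on \<Omega> f \<and> sobolev 2 Linf_on \<Omega> f"

definition W2inf_loc :: "('b::euclidean_space \<Rightarrow> real) \<Rightarrow> bool" where
  "W2inf_loc f \<longleftrightarrow> (\<forall>r>0. W2inf (ball 0 r) f)"


section \<open>Radial functions and balls\<close>

definition radial_on :: "'a::euclidean_space set \<Rightarrow> ('a \<Rightarrow> real) \<Rightarrow> bool" where
  "radial_on \<Omega> f \<longleftrightarrow> (\<forall>x\<in>\<Omega>. \<forall>y\<in>\<Omega>. norm x = norm y \<longrightarrow> f x = f y)"

definition radially_strictly_increasing_on :: "'a::euclidean_space set \<Rightarrow> ('a \<Rightarrow> real) \<Rightarrow> bool" where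
  "radially_strictly_increasing_on \<Omega> f \<longleftrightarrow> (\<forall>x\<in>\<Omega>. \<forall>y\<in>\<Omega>. norm x < norm y \<longrightarrow> f x < f y)"

text \<open>The origin is left out: a real-valued function that is non-increasing on the whole space,
  the origin included, would be bounded above by its value there, whereas an integrable
  non-increasing density may be singular at the origin.\<close>

definition radially_nonincreasing :: "('a::euclidean_space \<Rightarrow> real) \<Rightarrow> bool" where
  "radially_nonincreasing f \<longleftrightarrow> (\<forall>x y. x \<noteq> 0 \<and> norm x \<le> norm y \<longrightarrow> f y \<le> f x)"

definition unit_vol :: "'a::euclidean_space itself \<Rightarrow> real" where
  "unit_vol _ = measure lebesgue (ball (0::'a) 1)"

definition vol_ball :: "real \<Rightarrow> 'a::euclidean_space set" where
  "vol_ball v = ball 0 (root DIM('a) (v / unit_vol TYPE('a)))"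

text \<open>At a zero of \<open>V\<close> the density \<open>\<rho>\<^sub>V\<close> is infinite while \<^const>\<open>powr\<close> gives \<open>0\<close>. This
  concerns only the origin, a null set, when \<open>V\<close> is strictly increasing with \<open>V 0 = 0\<close>.\<close>

definition rho_V :: "real \<Rightarrow> ('a::euclidean_space \<Rightarrow> real) \<Rightarrow> 'a \<Rightarrow> real" where
  "rho_V m V x = ((1 - m) / m * V x) powr (- (1 / (1 - m)))"


section \<open>The problem in a ball\<close>

definition ball_potential ::
  "('a::euclidean_space \<Rightarrow> real) \<Rightarrow> real \<Rightarrow> ('a \<Rightarrow> real) \<Rightarrow> bool" where
  "ball_potential V R W \<longleftrightarrow>
     W2inf (ball 0 R) W \<and> radial_on (ball 0 R) W \<and> radially_strictly_increasing_on (ball 0 R) W \<and>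
     (\<forall>x\<in>ball 0 R. 0 \<le> W x \<and> W x \<le> V x) \<and>
     (\<forall>x. norm x \<le> R - 1 \<longrightarrow> W x = V x) \<and>
     (\<forall>y\<in>sphere 0 R. ((\<lambda>x. grad W x \<bullet> x) \<longlongrightarrow> 0) (at y within ball 0 R))"

text \<open>\<open>\<phi> \<in> C\<^sup>1([0,T]; L\<^sup>\<infinity>(\<Omega>))\<close> with time derivative \<open>\<phi>t\<close>\<close>

definition C1_time_Linf ::
  "real \<Rightarrow> 'a::euclidean_space set \<Rightarrow> (real \<Rightarrow> 'a \<Rightarrow> real) \<Rightarrow> (real \<Rightarrow> 'a \<Rightarrow> real) \<Rightarrow> bool" where
  "C1_time_Linf T \<Omega> \<phi> \<phi>t \<longleftrightarrow>
     (\<forall>t\<in>{0..T}. Linf_on \<Omega> (\<phi> t) \<and> Linf_on \<Omega> (\<phi>t t)) \<and>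
     (\<forall>t\<in>{0..T}. \<forall>e>0. \<exists>d>0. \<forall>s\<in>{0..T}. \<bar>s - t\<bar> < d \<longrightarrow>
        (AE x in lebesgue_on \<Omega>. \<bar>\<phi> s x - \<phi> t x - (s - t) * \<phi>t t x\<bar> \<le> e * \<bar>s - t\<bar>)) \<and>
     (\<forall>t\<in>{0..T}. \<forall>e>0. \<exists>d>0. \<forall>s\<in>{0..T}. \<bar>s - t\<bar> < d \<longrightarrow>
        (AE x in lebesgue_on \<Omega>. \<bar>\<phi>t s x - \<phi>t t x\<bar> \<le> e))"

text \<open>\<open>\<phi> \<in> L\<^sup>\<infinity>(0,T; W\<^bsup>2,\<infinity>\<^esup>(B\<^sub>R)) \<inter> C\<^sup>1([0,T]; L\<^sup>\<infinity>(B\<^sub>R))\<close> with time derivative \<open>\<phi>t\<close> and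
  spatial gradient \<open>D\<phi>\<close>\<close>

definition evolution_test ::
  "real \<Rightarrow> real \<Rightarrow> (real \<Rightarrow> 'a::euclidean_space \<Rightarrow> real) \<Rightarrow> (real \<Rightarrow> 'a \<Rightarrow> real) \<Rightarrow>
   (real \<Rightarrow> 'a \<Rightarrow> 'a) \<Rightarrow> bool" where
  "evolution_test T R \<phi> \<phi>t D\<phi> \<longleftrightarrow>
     C1_time_Linf T (ball 0 R) \<phi> \<phi>t \<and>
     (\<exists>C. AE t in lebesgue_on {0<..<T}. sobolev 2 (Linf_bounded C) (ball 0 R) (\<phi> t)) \<and>
     (AE t in lebesgue_on {0<..<T}. weak_gradient (ball 0 R) (\<phi> t) (D\<phi> t))"

definition cylinder :: "real \<Rightarrow> real \<Rightarrow> (real \<times> 'a::euclidean_space) set" where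
  "cylinder T R = {0<..<T} \<times> ball 0 R"

text \<open>Membership of \<open>\<rho>\<^sup>m\<close> in \<open>L\<^sup>1(0,T; W\<^bsup>1,1\<^esup>(B\<^sub>R))\<close> is expressed by joint integrability
  on the cylinder of \<open>\<rho>\<^sup>m\<close> and of its spatial weak gradient \<open>G\<close>. The no-flux boundary condition
  is contained in the weak formulation, since the test functions need not vanish on the sphere.\<close>

definition weak_L1_solution ::
  "real \<Rightarrow> real \<Rightarrow> ('a::euclidean_space \<Rightarrow> real) \<Rightarrow> real \<Rightarrow> ('a \<Rightarrow> real) \<Rightarrow> (real \<Rightarrow> 'a \<Rightarrow> real) \<Rightarrow> bool"
where
  "weak_L1_solution m R W T \<rho>0 \<rho> \<longleftrightarrow>
     integrable (lebesgue_on (cylinder T R)) (\<lambda>(t, x). \<rho> t x) \<and>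
     (AE (t, x) in lebesgue_on (cylinder T R). 0 \<le> \<rho> t x) \<and>
     integrable (lebesgue_on (cylinder T R)) (\<lambda>(t, x). \<rho> t x powr m) \<and>
     (\<exists>G :: real \<Rightarrow> 'a \<Rightarrow> 'a.
        integrable (lebesgue_on (cylinder T R)) (\<lambda>(t, x). G t x) \<and>
        (AE t in lebesgue_on {0<..<T}. weak_gradient (ball 0 R) (\<lambda>x. \<rho> t x powr m) (G t)) \<and>
        (\<forall>\<phi> \<phi>t D\<phi>. evolution_test T R \<phi> \<phi>t D\<phi> \<longrightarrow>
          (AE t in lebesgue_on {0<..<T}.
             (LINT x|lebesgue_on (ball 0 R). \<rho> t x * \<phi> t x)
             - (LINT s|lebesgue_on {0<..<t}. LINT x|lebesgue_on (ball 0 R). \<rho> s x * \<phi>t s x)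
             = - (LINT s|lebesgue_on {0<..<t}. LINT x|lebesgue_on (ball 0 R).
                    G s x \<bullet> D\<phi> s x + \<rho> s x * (grad W x \<bullet> D\<phi> s x))
               + (LINT x|lebesgue_on (ball 0 R). \<rho>0 x * \<phi> 0 x))))"

text \<open>Since \<open>H\<^sup>1((0,T) \<times> B\<^sub>R)\<close> embeds into \<open>C([0,T]; L\<^sup>2(B\<^sub>R))\<close>, continuity in time only fixes
  the representative, which gives the solution a value at every time.\<close>

definition regular_solution ::
  "real \<Rightarrow> real \<Rightarrow> ('a::euclidean_space \<Rightarrow> real) \<Rightarrow> ('a \<Rightarrow> real) \<Rightarrow> (real \<Rightarrow> 'a \<Rightarrow> real) \<Rightarrow> bool" where
  "regular_solution m R W \<rho>0 \<rho> \<longleftrightarrow>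
     (\<forall>T>0. weak_L1_solution m R W T \<rho>0 \<rho> \<and>
        sobolev 1 L2_on (cylinder T R) (\<lambda>(t, x). \<rho> t x) \<and>
        (\<exists>c>0. AE (t, x) in lebesgue_on (cylinder T R). c \<le> \<rho> t x)) \<and>
     (\<forall>t\<ge>0. integrable (lebesgue_on (ball 0 R)) (\<rho> t) \<and>
        ((\<lambda>s. LINT x|lebesgue_on (ball 0 R). \<bar>\<rho> s x - \<rho> t x\<bar>) \<longlongrightarrow> 0) (at t within {0..}))"

definition regular_datum :: "real \<Rightarrow> ('a::euclidean_space \<Rightarrow> real) \<Rightarrow> bool" where
  "regular_datum R f \<longleftrightarrow> sobolev 1 L2_on (ball 0 R) f \<and>
     (\<exists>\<epsilon>>0. AE x in lebesgue_on (ball 0 R). \<epsilon> \<le> f x \<and> f x \<le> 1 / \<epsilon>)"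

definition nonneg_L1 :: "real \<Rightarrow> ('a::euclidean_space \<Rightarrow> real) \<Rightarrow> bool" where
  "nonneg_L1 R f \<longleftrightarrow> integrable (lebesgue_on (ball 0 R)) f \<and> (AE x in lebesgue_on (ball 0 R). 0 \<le> f x)"

text \<open>\<open>S t f\<close> is the value at time \<open>t\<close> of the solution with datum \<open>f\<close>: the regular solution for
  regular data, extended to all nonnegative integrable data by continuity in \<open>L\<^sup>1(B\<^sub>R)\<close>. As regular
  solutions are unique and regular data are dense, this determines \<open>S t f\<close> up to null sets.\<close>

definition solution_operator ::
  "real \<Rightarrow> real \<Rightarrow> ('a::euclidean_space \<Rightarrow> real) \<Rightarrow> (real \<Rightarrow> ('a \<Rightarrow> real) \<Rightarrow> ('a \<Rightarrow> real)) \<Rightarrow> bool" where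
  "solution_operator m R W S \<longleftrightarrow>
     (\<forall>f. regular_datum R f \<longrightarrow> regular_solution m R W f (\<lambda>t. S t f)) \<and>
     (\<forall>t\<ge>0. \<forall>f. nonneg_L1 R f \<longrightarrow> nonneg_L1 R (S t f)) \<and>
     (\<forall>t\<ge>0. \<forall>f fs. nonneg_L1 R f \<and> (\<forall>k::nat. nonneg_L1 R (fs k)) \<and>
        (\<lambda>k. LINT x|lebesgue_on (ball 0 R). \<bar>fs k x - f x\<bar>) \<longlonglongrightarrow> 0 \<longrightarrow>
        (\<lambda>k. LINT x|lebesgue_on (ball 0 R). \<bar>S t (fs k) x - S t f x\<bar>) \<longlonglongrightarrow> 0)"


section \<open>Mass functions\<close>

definition ball_mass ::
  "real \<Rightarrow> (real \<Rightarrow> ('a::euclidean_space \<Rightarrow> real) \<Rightarrow> ('a \<Rightarrow> real)) \<Rightarrow> ('a \<Rightarrow> real) \<Rightarrow> real \<Rightarrow> real \<Rightarrow> real"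
where
  "ball_mass R S \<rho>0 t v =
     (if v \<le> unit_vol TYPE('a) * R ^ DIM('a)
      then LINT x|lebesgue_on (vol_ball v). S t \<rho>0 x
      else LINT x|lebesgue_on (ball 0 R). \<bar>\<rho>0 x\<bar>)"

definition viscosity_mass_solution ::
  "real \<Rightarrow> ('a::euclidean_space \<Rightarrow> real) \<Rightarrow> ('a \<Rightarrow> real) \<Rightarrow> (real \<Rightarrow> real \<Rightarrow> real) \<Rightarrow> bool" where
  "viscosity_mass_solution m V \<rho>0 M \<longleftrightarrow>
     (\<exists>W S (Rk :: nat \<Rightarrow> real).
        (\<forall>R>1. ball_potential V R (W R) \<and> solution_operator m R (W R) (S R)) \<and>
        (\<forall>k. Rk k > 1) \<and> filterlim Rk at_top sequentially \<and>
        (\<forall>K. compact K \<and> K \<subseteq> {0..} \<times> {0<..} \<longrightarrow>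
           uniform_limit K (\<lambda>k (t, v). ball_mass (Rk k) (S (Rk k)) \<rho>0 t v) (\<lambda>(t, v). M t v) sequentially))"

end

theory Submission
  imports Defs "HOL-Real_Asymp.Real_Asymp"
begin

text \<open>The bound \<open>V' \<le> C\<^sub>V r\<close> gives \<open>V \<le> C\<^sub>V r\<^sup>2\<close> near the origin, so the integrability of a power of
  \<open>\<rho>\<^sub>V\<close> above the first forces \<open>n \<ge> 3\<close>. In these dimensions \<open>q\<^sub>\<epsilon> = (\<epsilon>\<^sup>2 + r\<^sup>2)\<^bsup>-1/2\<^esup>\<close> is
  superharmonic. Let \<open>\<zeta>\<^sub>\<epsilon> = \<psi> (q\<^sub>\<epsilon> - 1 / R\<^sub>V)\<close> with \<open>\<psi> s = s exp (-1/s\<^sup>2)\<close> for \<open>s > 0\<close> and \<open>\<psi> s = 0\<close>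
  otherwise. As \<open>\<psi>\<close> is smooth, increasing, and concave for large \<open>s\<close>, \<open>\<zeta>\<^sub>\<epsilon>\<close> is a test function with
  support in the ball of radius \<open>R\<^sub>V\<close> whose Laplacian is bounded above uniformly in \<open>\<epsilon>\<close>, and the
  drift satisfies \<open>- \<nabla>V \<bullet> \<nabla>\<zeta>\<^sub>\<epsilon> \<le> A (1 + \<zeta>\<^sub>\<epsilon>)\<close>. Since \<open>\<rho>\<^sup>m \<le> 1 + \<rho>\<close>, testing the equation with
  \<open>1 + \<zeta>\<^sub>\<epsilon>\<close> and Gronwall's inequality bound \<open>\<integral> \<rho>(t) (1 + \<zeta>\<^sub>\<epsilon>)\<close> by \<open>\<integral> \<rho>\<^sub>0 (1 + \<zeta>\<^sub>\<epsilon>)\<close> up to constants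
  independent of \<open>\<epsilon>\<close> and of the ball \<open>B\<^sub>R\<close>, first for regular data and then by density. On \<open>B\<^sub>\<epsilon>\<close> the
  weight is at least a multiple of \<open>1 / \<epsilon>\<close>, whereas \<open>\<epsilon> \<integral> \<rho>\<^sub>0 (1 + \<zeta>\<^sub>\<epsilon>) \<rightarrow> 0\<close> by dominated convergence,
  so the mass in \<open>B\<^sub>\<epsilon>\<close> tends to \<open>0\<close> uniformly in \<open>R\<close>.\<close>

section \<open>Smooth functions\<close>

text \<open>\<open>Ck\<close> is phrased with the choice function \<open>frechet_derivative\<close>.
  This rule and the next one allow inductions on the order to work with any explicitly exhibited
  derivative.\<close>

lemma Ck_SucI:
  fixes f :: "'b::euclidean_space \<Rightarrow> real"
  assumes "\<And>x. (f has_derivative D x) (at x)" and "\<And>b. b \<in> Basis \<Longrightarrow> Ck k (\<lambda>x. D x b)"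
  shows "Ck (Suc k) f"
proof -
  have "frechet_derivative f (at x) = D x" for x
    using frechet_derivative_at[OF assms(1)] by simp
  then show ?thesis using assms by (auto simp: differentiable_def)
qed

lemma Ck_SucE:
  fixes f :: "'b::euclidean_space \<Rightarrow> real"
  assumes "Ck (Suc k) f"
  obtains D where "\<And>x. (f has_derivative D x) (at x)" and "\<And>b. b \<in> Basis \<Longrightarrow> Ck k (\<lambda>x. D x b)"
  using assms that[of "\<lambda>x. frechet_derivative f (at x)"] by (auto simp: frechet_derivative_works)

lemma Ck_Suc_imp: "Ck (Suc k) f \<Longrightarrow> Ck k f"
proof (induction k arbitrary: f)
  case 0
  then show ?case
    by (auto intro!: continuous_at_imp_continuous_on differentiable_imp_continuous_within)
next
  case (Suc k)
  then show ?case unfolding Ck.simps(2)[of "Suc k" f] by (auto simp del: Ck.simps(1))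
qed

lemma Ck_const: "Ck k (\<lambda>x::'b::euclidean_space. c)"
proof (induction k arbitrary: c)
  case (Suc k)
  show ?case by (rule Ck_SucI[of _ "\<lambda>x y. 0"]) (use Suc in auto)
qed simp

lemma Ck_inner_const: "Ck k (\<lambda>x::'b::euclidean_space. x \<bullet> c)"
proof (cases k)
  case (Suc j)
  show ?thesis unfolding Suc
    by (rule Ck_SucI[of _ "\<lambda>x y. y \<bullet> c"]) (auto intro!: derivative_eq_intros Ck_const)
qed (auto intro!: continuous_intros)

lemma Ck_add: "Ck k f \<Longrightarrow> Ck k g \<Longrightarrow> Ck k (\<lambda>x. f x + g x)"
proof (induction k arbitrary: f g)
  case 0
  then show ?case by (auto intro!: continuous_intros)
next
  case (Suc k)
  from Suc.prems obtain Df Dg where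
    "\<And>x. (f has_derivative Df x) (at x)" "\<And>b. b \<in> Basis \<Longrightarrow> Ck k (\<lambda>x. Df x b)"
    "\<And>x. (g has_derivative Dg x) (at x)" "\<And>b. b \<in> Basis \<Longrightarrow> Ck k (\<lambda>x. Dg x b)"
    by (elim Ck_SucE) blast
  with Suc.IH show ?case
    by (intro Ck_SucI[of _ "\<lambda>x b. Df x b + Dg x b"]) (auto intro!: derivative_eq_intros)
qed

lemma Ck_mult: "Ck k f \<Longrightarrow> Ck k g \<Longrightarrow> Ck k (\<lambda>x. f x * g x)"
proof (induction k arbitrary: f g)
  case 0
  then show ?case by (auto intro!: continuous_intros)
next
  case (Suc k)
  from Suc.prems obtain Df Dg where D:
    "\<And>x. (f has_derivative Df x) (at x)" "\<And>b. b \<in> Basis \<Longrightarrow> Ck k (\<lambda>x. Df x b)"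
    "\<And>x. (g has_derivative Dg x) (at x)" "\<And>b. b \<in> Basis \<Longrightarrow> Ck k (\<lambda>x. Dg x b)"
    by (elim Ck_SucE) blast
  show ?case
  proof (rule Ck_SucI)
    show "((\<lambda>x. f x * g x) has_derivative (\<lambda>h. f x * Dg x h + Df x h * g x)) (at x)" for x
      by (rule has_derivative_mult[OF D(1) D(3)])
    show "Ck k (\<lambda>x. f x * Dg x b + Df x b * g x)" if "b \<in> Basis" for b
      using that by (intro Ck_add Suc.IH D Ck_Suc_imp[OF Suc.prems(1)] Ck_Suc_imp[OF Suc.prems(2)])
  qed
qed

lemma Ck_compose:
  fixes F :: "real \<Rightarrow> real" and g :: "'b::euclidean_space \<Rightarrow> real"
  shows "Ck k F \<Longrightarrow> Ck k g \<Longrightarrow> Ck k (\<lambda>x. F (g x))"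
proof (induction k arbitrary: F g)
  case 0
  then show ?case by (auto intro: continuous_on_compose2)
next
  case (Suc k)
  from Suc.prems obtain DF Dg where D:
    "\<And>x. (F has_derivative DF x) (at x)" "Ck k (\<lambda>x. DF x 1)"
    "\<And>x. (g has_derivative Dg x) (at x)" "\<And>b. b \<in> Basis \<Longrightarrow> Ck k (\<lambda>x. Dg x b)"
    by (elim Ck_SucE) auto
  show ?case
  proof (rule Ck_SucI)
    show "((\<lambda>x. F (g x)) has_derivative (\<lambda>h. DF (g x) 1 * Dg x h)) (at x)" for x
    proof -
      \<comment> \<open>A linear map on the real line is multiplication by its value at 1. This puts
        the chain rule into product form, so \<open>Ck_mult\<close> applies.\<close>
      have eq: "DF (g x) h = DF (g x) 1 * h" for h
        using linear_cmul[OF has_derivative_linear[OF D(1)], of "g x" h 1] by (simp add: mult.commute)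
      have "(\<lambda>h. DF (g x) (Dg x h)) = (\<lambda>h. DF (g x) 1 * Dg x h)"
        by (rule ext) (rule eq)
      then show ?thesis
        using has_derivative_compose[OF D(3) D(1), of x] by simp
    qed
    show "Ck k (\<lambda>x. DF (g x) 1 * Dg x b)" if "b \<in> Basis" for b
      by (rule Ck_mult[OF Suc.IH[OF D(2) Ck_Suc_imp[OF Suc.prems(2)]] D(4)[OF that]])
  qed
qed

text \<open>Differentiation lowers the exponent by one and produces a linear factor, so the
  induction keeps \<open>a\<close> arbitrary. Positivity of \<epsilon> keeps the base away from 0,
  where \<open>powr\<close> is not smooth.\<close>

lemma Ck_norm_square_powr:
  fixes \<epsilon> a :: real
  assumes "\<epsilon> > 0"
  shows "Ck k (\<lambda>x::'b::euclidean_space. (\<epsilon>\<^sup>2 + x \<bullet> x) powr a)"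
proof -
  have pos: "\<epsilon>\<^sup>2 + x \<bullet> x > 0" for x :: 'b using assms by (simp add: add_pos_nonneg)
  show ?thesis
  proof (induction k arbitrary: a)
    case 0
    show ?case using pos by (auto intro!: continuous_intros simp: less_imp_neq[symmetric])
  next
    case (Suc k)
    show ?case
    proof (rule Ck_SucI)
      show "((\<lambda>x::'b. (\<epsilon>\<^sup>2 + x \<bullet> x) powr a) has_derivative
          (\<lambda>h. 2 * a * ((\<epsilon>\<^sup>2 + x \<bullet> x) powr (a - 1) * (x \<bullet> h)))) (at x)" for x
        using pos[of x]
        by (auto intro!: derivative_eq_intros simp: fun_eq_iff powr_diff inner_commute divide_simps)
      fix b :: 'b assume "b \<in> Basis"
      show "Ck k (\<lambda>x::'b. 2 * a * ((\<epsilon>\<^sup>2 + x \<bullet> x) powr (a - 1) * (x \<bullet> b)))"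
        by (intro Ck_mult Ck_const Suc Ck_inner_const)
    qed
  qed
qed

section \<open>Real powers damped to infinite order at zero\<close>

definition flat_powr :: "real \<Rightarrow> real \<Rightarrow> real" where
  "flat_powr a s = (if s > 0 then s powr a * exp (- 1 / s\<^sup>2) else 0)"

lemma flat_powr_tendsto_0: "((\<lambda>s::real. s powr a * exp (- 1 / s\<^sup>2)) \<longlongrightarrow> 0) (at_right 0)"
  by real_asymp

text \<open>The family over all real exponents is closed under differentiation up to linear
  combinations, which turns smoothness into an induction. The only delicate point is
  \<open>s = 0\<close>: the right difference quotient is the function with exponent
  \<open>a - 1\<close>, and the exponential factor beats every power.\<close>

lemma has_real_derivative_flat_powr:
  "(flat_powr a has_real_derivative a * flat_powr (a - 1) s + 2 * flat_powr (a - 3) s) (at s)"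
proof -
  consider "s > 0" | "s < 0" | "s = 0" by linarith
  then show ?thesis
  proof cases
    case 1
    have "((\<lambda>s. s powr a * exp (- 1 / s\<^sup>2)) has_real_derivative
      a * flat_powr (a - 1) s + 2 * flat_powr (a - 3) s) (at s)"
      using 1 by (auto intro!: derivative_eq_intros
        simp: flat_powr_def powr_diff power2_eq_square power3_eq_cube powr_numeral field_simps)
    moreover have "\<forall>\<^sub>F s in nhds s. flat_powr a s = s powr a * exp (- 1 / s\<^sup>2)"
      using eventually_nhds_in_open[of "{0<..}" s] 1
      by (auto elim!: eventually_mono simp: flat_powr_def)
    ultimately show ?thesis using DERIV_cong_ev by metis
  next
    case 2
    have "\<forall>\<^sub>F s in nhds s. flat_powr a s = 0"
      using eventually_nhds_in_open[of "{..<0}" s] 2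
      by (auto elim!: eventually_mono simp: flat_powr_def)
    then have "(flat_powr a has_real_derivative 0) (at s)"
      using DERIV_cong_ev[OF refl _ refl, of "flat_powr a" "\<lambda>_. 0"] by simp
    then show ?thesis using 2 by (simp add: flat_powr_def)
  next
    case 3
    have "((\<lambda>h. flat_powr a h / h) \<longlongrightarrow> 0) (at_right 0)"
    proof (rule Lim_transform_eventually[OF flat_powr_tendsto_0[of "a - 1"]])
      show "\<forall>\<^sub>F h in at_right 0. h powr (a - 1) * exp (- 1 / h\<^sup>2) = flat_powr a h / h"
        by (rule eventually_at_rightI[of 0 1]) (simp_all add: flat_powr_def powr_diff)
    qed
    moreover have "((\<lambda>h. flat_powr a h / h) \<longlongrightarrow> 0) (at_left 0)"
      by (intro tendsto_eventually eventually_at_leftI[of "-1"]) (simp_all add: flat_powr_def)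
    ultimately have "((\<lambda>h. flat_powr a h / h) \<longlongrightarrow> 0) (at 0)"
      using filterlim_at_split by blast
    then show ?thesis using 3 by (simp add: has_field_derivative_iff flat_powr_def)
  qed
qed

lemma Ck_flat_powr: "Ck k (flat_powr a)"
proof (induction k arbitrary: a)
  case 0
  show ?case
    using has_real_derivative_flat_powr by (auto intro!: continuous_at_imp_continuous_on DERIV_isCont)
next
  case (Suc k)
  show ?case
  proof (rule Ck_SucI)
    show "(flat_powr a has_derivative
        (\<lambda>h. (a * flat_powr (a - 1) s + 2 * flat_powr (a - 3) s) * h)) (at s)" for s
      using has_real_derivative_flat_powr[of a s] by (simp add: has_field_derivative_def)
  qed (auto intro!: Ck_mult Ck_add Ck_const Suc)
qed

section \<open>Integration by parts\<close>

lemma integral_lborel_translation: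
  fixes g :: "'b::euclidean_space \<Rightarrow> real"
  assumes [measurable]: "g \<in> borel_measurable borel"
  shows "(LINT x|lborel. g (c + x)) = (LINT x|lborel. g x)"
proof -
  have "distr lborel borel (\<lambda>x. c + x) = (lborel :: 'b measure)"
    using lborel_affine[of 1 c] by (simp add: density_1)
  then have "(LINT x|lborel. g x) = (LINT x|distr lborel borel ((+) c). g x)" by simp
  also have "\<dots> = (LINT x|lborel. g (c + x))" by (rule integral_distr) auto
  finally show ?thesis by simp
qed

lemma integral_lebesgue_on_support:
  fixes g :: "'b::euclidean_space \<Rightarrow> real"
  assumes "S \<in> sets lebesgue" and "\<And>x. x \<notin> S \<Longrightarrow> g x = 0"
  shows "(LINT x|lebesgue_on S. g x) = (LINT x|lebesgue. g x)"
proof -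
  have "(\<lambda>x. if x \<in> S then g x else 0) = g" using assms(2) by auto
  then show ?thesis using Lebesgue_Measure.integral_restrict_UNIV[OF assms(1), of g] by simp
qed

lemma integrable_lebesgue_on_compact:
  fixes g :: "'b::euclidean_space \<Rightarrow> real"
  assumes "compact K" "continuous_on K g"
  shows "integrable (lebesgue_on K) g"
proof -
  have "integrable lborel (\<lambda>x. indicator K x *\<^sub>R g x)"
    by (rule borel_integrable_compact[OF assms])
  then have "integrable lebesgue (\<lambda>x. indicator K x *\<^sub>R g x)"
    by (subst integrable_completion) auto
  then show ?thesis
    by (subst integrable_restrict_space) (use assms in \<open>auto intro: fmeasurableD lmeasurable_compact\<close>)
qed

lemma integrable_lebesgue_on_mono:
  fixes g :: "'b::euclidean_space \<Rightarrow> real"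
  assumes g: "integrable (lebesgue_on T) g" and "S \<subseteq> T" "S \<in> sets lebesgue" "T \<in> sets lebesgue"
  shows "integrable (lebesgue_on S) g"
proof -
  have "integrable lebesgue (\<lambda>x. indicator S x *\<^sub>R indicator T x *\<^sub>R g x)"
    using g assms(3,4) by (intro integrable_mult_indicator[of S]) (simp_all add: integrable_restrict_space)
  also have "(\<lambda>x. indicator S x *\<^sub>R indicator T x *\<^sub>R g x) = (\<lambda>x. indicator S x *\<^sub>R g x)"
    using assms(2) by (auto simp: indicator_def fun_eq_iff)
  finally show ?thesis using assms(3) by (simp add: integrable_restrict_space)
qed

lemma integrable_compact_support:
  fixes g :: "'b::euclidean_space \<Rightarrow> real"
  assumes "continuous_on UNIV g" "compact K" "\<And>x. x \<notin> K \<Longrightarrow> g x = 0"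
  shows "integrable lborel g" "integrable lebesgue g"
proof -
  have "(\<lambda>x. indicator K x *\<^sub>R g x) = g" using assms(3) by (fastforce simp: indicator_def)
  then show *: "integrable lborel g"
    using borel_integrable_compact[OF assms(2) continuous_on_subset[OF assms(1)]] by simp
  then show "integrable lebesgue g"
    by (subst integrable_completion) (use borel_measurable_continuous_onI[OF assms(1)] in auto)
qed

lemma has_derivative_0_outside_support:
  assumes "(g has_derivative D) (at x)" "closed K" "\<And>x. x \<notin> K \<Longrightarrow> g x = 0" "x \<notin> K"
  shows "D = (\<lambda>_. 0)"
proof -
  have "((\<lambda>_. 0) has_derivative D) (at x)"
    by (rule has_derivative_transform_within_open[OF assms(1), of "- K"]) (use assms in auto)
  then show ?thesis using has_derivative_unique has_derivative_const by blast
qed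

text \<open>By translation invariance the difference quotients of \<open>g\<close> in direction
  \<open>b\<close> have integral 0. They converge to the directional derivative and are dominated by
  a constant on one fixed ball, so the limit also has integral 0.\<close>

lemma integral_derivative_compact_support:
  fixes g :: "'b::euclidean_space \<Rightarrow> real"
  assumes D: "\<And>x. (g has_derivative D x) (at x)"
    and cont: "continuous_on UNIV (\<lambda>x. D x b)"
    and K: "compact K" "\<And>x. x \<notin> K \<Longrightarrow> g x = 0"
  shows "(LINT x|lebesgue. D x b) = 0"
proof -
  \<comment> \<open>Step sizes at most 1 keep all the shifted supports inside the ball of radius
    \<open>r + norm b\<close>.\<close>
  define h where "h k = inverse (real (Suc k))" for k
  define s where "s k x = (g (h k *\<^sub>R b + x) - g x) / h k" for k x
  have h: "0 < h k" "h k \<le> 1" for k by (auto simp: h_def inverse_le_1_iff)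
  have D0: "D x b = 0" if "x \<notin> K" for x
    using has_derivative_0_outside_support[OF D compact_imp_closed[OF K(1)] K(2) that] by simp
  have gc: "continuous_on UNIV g"
    using D by (auto intro!: continuous_at_imp_continuous_on has_derivative_continuous)
  note [measurable] = borel_measurable_continuous_onI[OF gc] borel_measurable_continuous_onI[OF cont]
  have gi: "integrable lborel g" by (rule integrable_compact_support[OF gc K])
  obtain r where r: "\<And>x. x \<in> K \<Longrightarrow> norm x \<le> r"
    using compact_imp_bounded[OF K(1)] by (auto simp: bounded_iff)
  obtain B where B: "B \<ge> 0" "\<bar>D x b\<bar> \<le> B" for x
  proof -
    have "bounded ((\<lambda>x. D x b) ` K)"
      by (intro compact_imp_bounded compact_continuous_image continuous_on_subset[OF cont] K) auto
    then obtain B where "\<And>x. x \<in> K \<Longrightarrow> \<bar>D x b\<bar> \<le> B" by (auto simp: bounded_iff)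
    then show ?thesis using that[of "max 0 B"] D0 by (metis abs_zero max.cobounded1 max.coboundedI2)
  qed
  have der: "((\<lambda>t. g (t *\<^sub>R b + x)) has_real_derivative D (t *\<^sub>R b + x) b) (at t)" for x t
  proof -
    have "((\<lambda>t. g (t *\<^sub>R b + x)) has_derivative (\<lambda>u. D (t *\<^sub>R b + x) (u *\<^sub>R b))) (at t)"
      by (rule has_derivative_compose[OF _ D]) (auto intro!: derivative_eq_intros)
    moreover have "(\<lambda>u. D (t *\<^sub>R b + x) (u *\<^sub>R b)) = (*) (D (t *\<^sub>R b + x) b)"
      by (rule ext) (simp add: linear_cmul[OF has_derivative_linear[OF D]])
    ultimately show ?thesis by (simp add: has_field_derivative_def)
  qed
  have bound: "norm (s k x) \<le> B * indicator (cball 0 (r + norm b)) x" for k x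
  proof (cases "norm x \<le> r + norm b")
    case True
    obtain z where z: "g (h k *\<^sub>R b + x) - g (0 *\<^sub>R b + x) = (h k - 0) * D (z *\<^sub>R b + x) b"
      using MVT2[OF h(1)[of k] der] by blast
    then have "s k x = D (z *\<^sub>R b + x) b" using h[of k] by (simp add: s_def)
    then show ?thesis using B True by simp
  next
    case False
    have "norm x \<le> norm (h k *\<^sub>R b + x) + norm (h k *\<^sub>R b)"
      by (metis add.commute add_diff_cancel_left' norm_triangle_sub norm_minus_commute)
    also have "norm (h k *\<^sub>R b) \<le> norm b"
      using h[of k] by (simp add: mult_left_le_one_le)
    finally have "x \<notin> K" "h k *\<^sub>R b + x \<notin> K"
      using False r[of x] r[of "h k *\<^sub>R b + x"] norm_ge_zero[of b] by linarith+
    then show ?thesis using K(2) False by (simp add: s_def)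
  qed
  have "(\<lambda>k. LINT x|lborel. s k x) \<longlonglongrightarrow> (LINT x|lborel. D x b)"
  proof (rule integral_dominated_convergence)
    show "integrable lborel (\<lambda>x. B * indicator (cball 0 (r + norm b)) x)"
      by (intro integrable_mult_right integrable_real_indicator) (use emeasure_bounded_finite[OF bounded_cball] in auto)
    show "AE x in lborel. (\<lambda>k. s k x) \<longlonglongrightarrow> D x b"
    proof (rule AE_I2)
      fix x
      have "((\<lambda>t. (g (t *\<^sub>R b + x) - g x) / t) \<longlongrightarrow> D x b) (at 0)"
        using der[of x 0] by (simp add: has_field_derivative_iff)
      moreover have "filterlim h (at 0) sequentially"
        unfolding filterlim_at using h LIMSEQ_inverse_real_of_nat
        by (auto simp: h_def[abs_def] intro!: always_eventually)
      ultimately show "(\<lambda>k. s k x) \<longlonglongrightarrow> D x b"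
        unfolding s_def by (rule filterlim_compose)
    qed
  qed (use bound in \<open>auto simp: s_def\<close>)
  moreover have "(LINT x|lborel. s k x) = 0" for k
  proof -
    have "integrable lborel (\<lambda>x. g (h k *\<^sub>R b + x))"
    proof (rule integrable_compact_support)
      show "compact ((+) (- h k *\<^sub>R b) ` K)" using K by (intro compact_translation)
      show "g (h k *\<^sub>R b + x) = 0" if "x \<notin> (+) (- h k *\<^sub>R b) ` K" for x
        using that by (intro K(2)) (force simp: image_iff)
    qed (auto intro!: continuous_intros continuous_on_compose2[OF gc])
    then show ?thesis
      by (simp add: s_def Bochner_Integration.integral_diff gi integral_lborel_translation)
  qed
  ultimately have "(LINT x|lborel. D x b) = 0" by (simp add: LIMSEQ_const_iff)
  then show ?thesis by (simp add: integral_completion)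
qed

lemma locally_integrable_continuous:
  "continuous_on \<Omega> f \<Longrightarrow> locally_integrable \<Omega> f"
  unfolding locally_integrable_def
  by (auto intro!: integrable_lebesgue_on_compact intro: continuous_on_subset)

lemma test_functionE:
  assumes "test_function \<Omega> \<eta>"
  obtains K where "compact K" "K \<subseteq> \<Omega>" "\<And>x. x \<notin> K \<Longrightarrow> \<eta> x = 0"
    "\<And>x. x \<notin> K \<Longrightarrow> frechet_derivative \<eta> (at x) = (\<lambda>_. 0)"
    "\<And>x. (\<eta> has_derivative frechet_derivative \<eta> (at x)) (at x)"
    "continuous_on UNIV \<eta>" "\<And>b. b \<in> Basis \<Longrightarrow> continuous_on UNIV (\<lambda>x. frechet_derivative \<eta> (at x) b)"
proof
  let ?K = "closure {x. \<eta> x \<noteq> 0}"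
  show 0: "\<eta> x = 0" if "x \<notin> ?K" for x using that closure_subset[of "{x. \<eta> x \<noteq> 0}"] by auto
  have "Ck 1 \<eta>" "Ck 0 \<eta>" using assms by (auto simp: test_function_def)
  then show D: "(\<eta> has_derivative frechet_derivative \<eta> (at x)) (at x)" for x
    by (auto simp: frechet_derivative_works)
  show "frechet_derivative \<eta> (at x) = (\<lambda>_. 0)" if "x \<notin> ?K" for x
    by (rule has_derivative_0_outside_support[OF D _ 0 that]) auto
  show "continuous_on UNIV \<eta>" using \<open>Ck 0 \<eta>\<close> by simp
  show "continuous_on UNIV (\<lambda>x. frechet_derivative \<eta> (at x) b)" if "b \<in> Basis" for b
    using \<open>Ck 1 \<eta>\<close> that by simp
qed (use assms in \<open>auto simp: test_function_def\<close>)

text \<open>The product of \<open>f\<close> with a test function has compact support, so the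
  integral of its classical derivative vanishes; the product rule splits this into the weak
  identity.\<close>

lemma weak_partial_C1:
  fixes f :: "'b::euclidean_space \<Rightarrow> real"
  assumes f: "Ck 1 f" and b: "b \<in> Basis" and \<Omega>: "\<Omega> \<in> sets lebesgue"
  shows "weak_partial \<Omega> b f (\<lambda>x. frechet_derivative f (at x) b)"
  unfolding weak_partial_def
proof (intro conjI allI impI)
  have D: "(f has_derivative frechet_derivative f (at x)) (at x)" for x
    using f by (auto simp: frechet_derivative_works)
  have fc: "continuous_on UNIV f"
    using D by (auto intro!: continuous_at_imp_continuous_on has_derivative_continuous)
  have Dc: "continuous_on UNIV (\<lambda>x. frechet_derivative f (at x) b)" using f b by simp
  show "locally_integrable \<Omega> f" "locally_integrable \<Omega> (\<lambda>x. frechet_derivative f (at x) b)"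
    using fc Dc by (auto intro!: locally_integrable_continuous intro: continuous_on_subset)
  fix \<eta> assume "test_function \<Omega> \<eta>"
  then obtain K where K: "compact K" "K \<subseteq> \<Omega>" "\<And>x. x \<notin> K \<Longrightarrow> \<eta> x = 0"
    "\<And>x. x \<notin> K \<Longrightarrow> frechet_derivative \<eta> (at x) = (\<lambda>_. 0)"
    "\<And>x. (\<eta> has_derivative frechet_derivative \<eta> (at x)) (at x)"
    "continuous_on UNIV \<eta>" "\<And>b. b \<in> Basis \<Longrightarrow> continuous_on UNIV (\<lambda>x. frechet_derivative \<eta> (at x) b)"
    by (elim test_functionE) (rule that; simp)
  let ?A = "\<lambda>x. f x * frechet_derivative \<eta> (at x) b" and ?B = "\<lambda>x. frechet_derivative f (at x) b * \<eta> x"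
  have "(LINT x|lebesgue. ?A x + ?B x) = 0"
  proof (rule integral_derivative_compact_support[where g = "\<lambda>x. f x * \<eta> x"
        and D = "\<lambda>x h. f x * frechet_derivative \<eta> (at x) h + frechet_derivative f (at x) h * \<eta> x"])
    show "((\<lambda>x. f x * \<eta> x) has_derivative
      (\<lambda>h. f x * frechet_derivative \<eta> (at x) h + frechet_derivative f (at x) h * \<eta> x)) (at x)" for x
      by (rule has_derivative_mult[OF D K(5)])
  qed (use K(1-6) K(7)[OF b] fc Dc in \<open>auto intro!: continuous_intros\<close>)
  moreover have "integrable lebesgue ?A" "integrable lebesgue ?B"
    by (rule integrable_compact_support(2)[OF _ K(1)]; use K(1-6) K(7)[OF b] fc Dc in \<open>auto intro!: continuous_intros\<close>)+
  ultimately have "(LINT x|lebesgue. ?A x) = - (LINT x|lebesgue. ?B x)" by simp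
  \<comment> \<open>Both integrands vanish off \<Omega>, so integrals over \<Omega> and over the
    whole space agree.\<close>
  moreover have off: "\<eta> x = 0" "frechet_derivative \<eta> (at x) = (\<lambda>_. 0)" if "x \<notin> \<Omega>" for x
    using that K(2) by (intro K(3,4); blast)+
  have "(LINT x|lebesgue_on \<Omega>. ?A x) = (LINT x|lebesgue. ?A x)"
    "(LINT x|lebesgue_on \<Omega>. ?B x) = (LINT x|lebesgue. ?B x)"
    by (rule integral_lebesgue_on_support[OF \<Omega>]; use off in simp)+
  ultimately show "(LINT x|lebesgue_on \<Omega>. ?A x) = - (LINT x|lebesgue_on \<Omega>. ?B x)" by simp
qed

section \<open>Density of regular data\<close>

lemma integrable_lebesgue_on_ball:
  fixes g :: "'b::euclidean_space \<Rightarrow> real"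
  assumes "continuous_on UNIV g"
  shows "integrable (lebesgue_on (ball a R)) g"
  by (rule integrable_lebesgue_on_mono[OF integrable_lebesgue_on_compact[OF compact_cball[of a R]
        continuous_on_subset[OF assms]]]) auto

lemma L2_on_ball_continuous:
  assumes "continuous_on UNIV g"
  shows "L2_on (ball a R) g"
  unfolding L2_on_def
proof
  show "g \<in> borel_measurable (lebesgue_on (ball a R))"
    by (intro borel_measurable_integrable integrable_lebesgue_on_ball assms)
  show "integrable (lebesgue_on (ball a R)) (\<lambda>x. (g x)\<^sup>2)"
    by (intro integrable_lebesgue_on_ball continuous_intros assms)
qed

lemma Ck_real_polynomial_function:
  fixes p :: "'b::euclidean_space \<Rightarrow> real"
  shows "real_polynomial_function p \<Longrightarrow> Ck k p"
proof (induction rule: real_polynomial_function.induct)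
  case (linear f)
  show ?case
  proof (cases k)
    case 0
    then show ?thesis using linear linear_continuous_on by simp
  next
    case (Suc j)
    show ?thesis unfolding Suc
      by (rule Ck_SucI[of _ "\<lambda>_. f"])
        (auto intro: bounded_linear_imp_has_derivative linear Ck_const)
  qed
qed (auto intro: Ck_const Ck_add Ck_mult)

lemma regular_datum_C1:
  fixes f :: "'b::euclidean_space \<Rightarrow> real"
  assumes f: "Ck 1 f" and "\<epsilon> > 0" "\<And>x. x \<in> ball 0 R \<Longrightarrow> \<epsilon> \<le> f x \<and> f x \<le> 1 / \<epsilon>"
  shows "regular_datum R f"
proof -
  have "Ck 0 f" using Ck_Suc_imp[of 0 f] f by simp
  moreover have "continuous_on UNIV (\<lambda>x. frechet_derivative f (at x) b)" if "b \<in> Basis" for b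
    using f that by simp
  moreover have "weak_partial (ball 0 R) b f (\<lambda>x. frechet_derivative f (at x) b)" if "b \<in> Basis" for b
    by (rule weak_partial_C1[OF f that]) auto
  ultimately have "sobolev 1 L2_on (ball 0 R) f"
    by (auto intro!: exI[of _ "\<lambda>x. frechet_derivative f (at x) _"] L2_on_ball_continuous)
  then show ?thesis unfolding regular_datum_def using assms(2,3) by (auto intro!: exI[of _ \<epsilon>] AE_I2)
qed

lemma tendsto_integral_abs_diff:
  fixes f :: "'b \<Rightarrow> real"
  assumes f: "f \<in> borel_measurable M" and s: "\<And>i. s i \<in> borel_measurable M" and w: "integrable M w"
    and lim: "AE x in M. (\<lambda>i. s i x) \<longlonglongrightarrow> f x"
    and bound: "\<And>i::nat. AE x in M. \<bar>s i x - f x\<bar> \<le> w x"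
  shows "(\<lambda>i. LINT x|M. \<bar>s i x - f x\<bar>) \<longlonglongrightarrow> 0"
proof -
  have "(\<lambda>i. LINT x|M. \<bar>s i x - f x\<bar>) \<longlonglongrightarrow> (LINT x|M. 0)"
  proof (rule integral_dominated_convergence[OF _ _ w])
    show "AE x in M. (\<lambda>i. \<bar>s i x - f x\<bar>) \<longlonglongrightarrow> 0"
      using lim by eventually_elim (simp add: tendsto_rabs_zero_iff LIM_zero_iff)
  qed (use f s bound in auto)
  then show ?thesis by simp
qed

text \<open>Three approximations, each costing at most \<open>e / 3\<close> in the L1 norm: truncate
  \<open>f\<close> at height \<open>k\<close>, replace the truncation by a continuous function, and
  replace that by a polynomial shifted upwards so that it stays positive.\<close>

lemma regular_datum_dense:
  fixes f :: "'b::euclidean_space \<Rightarrow> real"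
  assumes f: "nonneg_L1 R f" and e: "e > 0"
  obtains g where "regular_datum R g" "integrable (lebesgue_on (ball 0 R)) g"
    "(LINT x|lebesgue_on (ball 0 R). \<bar>g x - f x\<bar>) < e"
proof -
  let ?B = "ball (0::'b) R" and ?M = "lebesgue_on (ball (0::'b) R)"
  have fi: "integrable ?M f" and f0: "AE x in ?M. 0 \<le> f x" using f by (auto simp: nonneg_L1_def)
  note [measurable] = borel_measurable_integrable[OF fi]
  interpret finite_measure ?M by (rule finite_measure_lebesgue_on) auto
  have "(\<lambda>k. LINT x|?M. \<bar>min (f x) (real k) - f x\<bar>) \<longlonglongrightarrow> 0"
  proof (rule tendsto_integral_abs_diff)
    show "AE x in ?M. (\<lambda>k. min (f x) (real k)) \<longlonglongrightarrow> f x"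
    proof (rule AE_I2)
      fix x
      have "\<forall>\<^sub>F k in sequentially. f x \<le> real k"
        using filterlim_real_sequentially by (auto simp: filterlim_at_top)
      then show "(\<lambda>k. min (f x) (real k)) \<longlonglongrightarrow> f x"
        by (intro tendsto_eventually) (auto elim: eventually_mono)
    qed
    show "AE x in ?M. \<bar>min (f x) (real k) - f x\<bar> \<le> \<bar>f x\<bar>" for k
      using f0 by eventually_elim auto
  qed (use fi in auto)
  then obtain k where k: "(LINT x|?M. \<bar>min (f x) (real k) - f x\<bar>) < e / 3"
    using e by (force dest!: order_tendstoD(2)[where a = "e / 3"] simp: eventually_sequentially)
  define u where "u x = min (f x) (real k)" for x
  have [measurable]: "u \<in> borel_measurable ?M" unfolding u_def[abs_def] by measurable
  \<comment> \<open>\<open>measurable_on\<close> supplies functions continuous on the whole space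
    that converge to \<open>u\<close> off a null set.\<close>
  then have "u measurable_on ?B" by (simp add: measurable_on_iff_borel_measurable)
  then obtain N g where N: "negligible N" and gc: "\<And>n. continuous_on UNIV (g n)"
    and g: "\<And>x. x \<notin> N \<Longrightarrow> (\<lambda>n. g n x) \<longlonglongrightarrow> (if x \<in> ?B then u x else 0)"
    unfolding measurable_on_def by blast
  have [measurable]: "g n \<in> borel_measurable ?M" for n
    by (intro borel_measurable_integrable integrable_lebesgue_on_ball gc)
  \<comment> \<open>Clipping to the range of \<open>u\<close> makes the constant \<open>k\<close> a
    dominating function on the ball.\<close>
  define c where "c n x = max 0 (min (g n x) (real k))" for n x
  have "(\<lambda>n. LINT x|?M. \<bar>c n x - u x\<bar>) \<longlonglongrightarrow> 0"
  proof (rule tendsto_integral_abs_diff)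
    have "AE x in ?M. x \<notin> N"
      using N by (auto simp: AE_restrict_space_iff negligible_iff_null_sets intro: AE_mp[OF AE_not_in])
    then show "AE x in ?M. (\<lambda>n. c n x) \<longlonglongrightarrow> u x"
      using f0 AE_space
    proof eventually_elim
      case (elim x)
      then have "(\<lambda>n. g n x) \<longlonglongrightarrow> u x" using g[of x] by simp
      then have "(\<lambda>n. c n x) \<longlonglongrightarrow> max 0 (min (u x) (real k))"
        unfolding c_def by (intro tendsto_intros)
      then show ?case using elim by (simp add: u_def)
    qed
    show "AE x in ?M. \<bar>c n x - u x\<bar> \<le> real k" for n
      using f0 by eventually_elim (auto simp: c_def u_def)
  qed (auto simp: c_def)
  then obtain n where n: "(LINT x|?M. \<bar>c n x - u x\<bar>) < e / 3"
    using e by (force dest!: order_tendstoD(2)[where a = "e / 3"] simp: eventually_sequentially)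
  \<comment> \<open>The polynomial will differ from \<open>c n\<close> by at most
    \<open>3 * d\<close>, and this choice makes the resulting error at most \<open>e / 3\<close>;
    the summand 1 keeps the denominator positive.\<close>
  define d where "d = e / 3 / (3 * (measure ?M ?B + 1))"
  have d: "d > 0" using e by (simp add: d_def add_nonneg_pos)
  \<comment> \<open>Approximating the function raised by \<open>2 * d\<close> to within
    \<open>d\<close> forces the polynomial to lie between \<open>d\<close> and
    \<open>k + 3 * d\<close> on the ball.\<close>
  have "continuous_on (cball 0 R) (\<lambda>x. c n x + 2 * d)"
    unfolding c_def by (intro continuous_intros continuous_on_subset[OF gc]) auto
  then obtain p where p: "real_polynomial_function p"
      "\<And>x. x \<in> cball 0 R \<Longrightarrow> \<bar>c n x + 2 * d - p x\<bar> < d"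
    using Stone_Weierstrass_real_polynomial_function[OF compact_cball _ d] by metis
  have pc: "\<bar>p x - c n x\<bar> \<le> 3 * d" "d \<le> p x" "p x \<le> real k + 3 * d" if "x \<in> ?B" for x
    using p(2)[of x] that by (auto simp: c_def)
  show ?thesis
  proof (rule that)
    show "regular_datum R p"
    proof (rule regular_datum_C1[OF Ck_real_polynomial_function[OF p(1)]])
      let ?\<epsilon> = "min d (1 / (real k + 3 * d))"
      show "?\<epsilon> > 0" using d by (auto intro: add_nonneg_pos)
      fix x assume "x \<in> ?B"
      have "real k + 3 * d \<le> 1 / ?\<epsilon>"
        using d by (auto simp: min_def field_simps add_nonneg_pos)
      then show "?\<epsilon> \<le> p x \<and> p x \<le> 1 / ?\<epsilon>" using pc[OF \<open>x \<in> ?B\<close>] by linarith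
    qed
    have "Ck 0 p" by (rule Ck_real_polynomial_function[OF p(1)])
    then show pi: "integrable ?M p"
      by (intro integrable_lebesgue_on_ball) simp
    have ci: "integrable ?M (c n)"
      unfolding c_def by (intro integrable_lebesgue_on_ball continuous_intros gc)
    have ui: "integrable ?M u"
      unfolding u_def by (rule integrable_min) (use fi in auto)
    have "(LINT x|?M. \<bar>p x - f x\<bar>) \<le> (LINT x|?M. \<bar>p x - c n x\<bar> + \<bar>c n x - u x\<bar> + \<bar>u x - f x\<bar>)"
      using pi ci ui fi by (intro integral_mono) auto
    also have "\<dots> = (LINT x|?M. \<bar>p x - c n x\<bar>) + (LINT x|?M. \<bar>c n x - u x\<bar>) + (LINT x|?M. \<bar>u x - f x\<bar>)"
      using pi ci ui fi by simp
    also have "(LINT x|?M. \<bar>p x - c n x\<bar>) \<le> (LINT x|?M. 3 * d)"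
      using pi ci pc by (intro integral_mono) auto
    also have "(LINT x|?M. 3 * d) = 3 * d * measure ?M ?B" by simp
    also have "\<dots> \<le> 3 * d * (measure ?M ?B + 1)" using d by simp
    also have "\<dots> = e / 3"
    proof -
      have "3 * (e / 3 / (3 * y)) * y = e / 3" if "y > 0" for y :: real using that by simp
      moreover have "measure ?M ?B + 1 > 0" by (rule add_nonneg_pos) auto
      ultimately show ?thesis unfolding d_def by blast
    qed
    finally show "(LINT x|?M. \<bar>p x - f x\<bar>) < e" using n k by (simp add: u_def)
  qed
qed

section \<open>Gronwall's inequality from an integral inequality valid almost everywhere\<close>

lemma continuous_AE_le_imp_le:
  fixes g h :: "real \<Rightarrow> real"
  assumes U: "open U" and g: "continuous_on U g" and h: "continuous_on U h"
    and ae: "AE t in lebesgue_on U. g t \<le> h t" and t: "t \<in> U"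
  shows "g t \<le> h t"
proof (rule ccontr)
  let ?N = "U \<inter> (\<lambda>s. g s - h s) -` {0<..}"
  assume "\<not> g t \<le> h t"
  then have "?N \<noteq> {}" using t by auto
  moreover have "open ?N"
    by (intro continuous_open_preimage continuous_intros g h U)
  ultimately have "\<not> negligible ?N" by (metis open_not_negligible)
  moreover have "AE s in lebesgue. s \<notin> ?N"
    using ae U by (auto simp: AE_restrict_space_iff elim!: eventually_mono)
  then have "negligible ?N"
    using \<open>open ?N\<close> by (subst negligible_iff_null_sets, subst AE_iff_null_sets) auto
  ultimately show False by simp
qed

text \<open>The weak formulation holds only for almost every time, and continuity of
  \<open>y\<close> upgrades the inequality to every time: a failure set would be open and nonempty,
  hence not negligible. The classical argument with an integrating factor follows.\<close>

lemma gronwall_AE: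
  fixes y :: "real \<Rightarrow> real"
  assumes y: "continuous_on {0..} y" and k: "k > 0"
    and le: "\<And>T. T > 0 \<Longrightarrow> AE t in lebesgue_on {0<..<T}. y t \<le> B + (LINT s|lebesgue_on {0<..<t}. a + k * y s)"
    and t: "t > 0"
  shows "y t \<le> (B + a / k) * exp (k * t) - a / k"
proof -
  define T where "T = t + 1"
  define I where "I t = integral {0..t} (\<lambda>s. a + k * y s)" for t
  \<comment> \<open>The shift by \<open>a / k\<close> makes the differential inequality for the
    integral homogeneous: \<open>B + a / k + I s\<close> has derivative \<open>a + k * y s\<close>,
    which is at most \<open>k\<close> times itself. So the factor \<open>exp (- k * s)\<close> makes
    \<open>F\<close> non-increasing.\<close>
  define F where "F s = (B + a / k + I s) * exp (- k * s)" for s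
  have T: "0 < t" "t < T" using t by (auto simp: T_def)
  have c: "continuous_on {0..u} (\<lambda>s. a + k * y s)" for u
    by (intro continuous_intros continuous_on_subset[OF y]) auto
  have L: "(LINT s|lebesgue_on {0<..<u}. a + k * y s) = I u" for u
  proof -
    have "integrable (lebesgue_on {0<..<u}) (\<lambda>s. a + k * y s)"
      by (rule integrable_lebesgue_on_mono[OF integrable_lebesgue_on_compact[OF compact_Icc c[of u]]]) auto
    then show ?thesis by (simp add: lebesgue_integral_eq_integral I_def integral_open_interval_real)
  qed
  have I: "(I has_real_derivative a + k * y s) (at s)" if "s \<in> {0<..<T}" for s
    using integral_has_real_derivative[OF c[of T], of s] that at_within_Icc_at[of 0 s T]
    by (simp add: I_def[abs_def])
  have Ic: "continuous_on {0..T} I"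
    unfolding I_def by (intro indefinite_integral_continuous_1 integrable_continuous_real c)
  have yI: "y s \<le> B + I s" if "s \<in> {0<..<T}" for s
  proof (rule continuous_AE_le_imp_le[OF _ _ _ _ that])
    show "AE t in lebesgue_on {0<..<T}. y t \<le> B + I t" using le[of T] T by (simp add: L)
    show "continuous_on {0<..<T} y" by (rule continuous_on_subset[OF y]) auto
    show "continuous_on {0<..<T} (\<lambda>t. B + I t)"
      by (intro continuous_intros continuous_on_subset[OF Ic]) auto
  qed auto
  have "F t \<le> F 0"
  proof (rule DERIV_nonpos_imp_decreasing_open[of 0 t F])
    fix s assume s: "0 < s" "s < t"
    have "(F has_real_derivative (a + k * y s) * exp (- k * s) + (B + a / k + I s) * (exp (- k * s) * - k)) (at s)"
      unfolding F_def using s T by (auto intro!: derivative_eq_intros I)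
    moreover have "(a + k * y s) * exp (- k * s) + (B + a / k + I s) * (exp (- k * s) * - k)
        = k * exp (- k * s) * (y s - (B + I s))" using k by (simp add: field_simps)
    moreover have "\<dots> \<le> 0" using yI[of s] s T k by (intro mult_nonneg_nonpos) auto
    ultimately show "\<exists>y. (F has_real_derivative y) (at s) \<and> y \<le> 0" by metis
  qed (use T in \<open>auto simp: F_def intro!: continuous_intros continuous_on_subset[OF Ic]\<close>)
  also have "F 0 = B + a / k" by (simp add: F_def I_def)
  finally have "B + a / k + I t \<le> (B + a / k) * exp (k * t)"
    by (simp add: F_def exp_minus field_simps)
  then show ?thesis using yI[of t] T by simp
qed

section \<open>Test functions independent of time\<close>

lemma grad_inner:
  assumes "b \<in> Basis" shows "grad f x \<bullet> b = frechet_derivative f (at x) b"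
  using assms by (simp add: grad_def inner_sum_left inner_Basis if_distrib sum.delta cong: if_cong)

lemma test_function_partial:
  assumes "test_function \<Omega> \<zeta>" "b \<in> Basis"
  shows "test_function \<Omega> (\<lambda>x. frechet_derivative \<zeta> (at x) b)"
proof -
  from assms(1) obtain K where K: "compact K" "K \<subseteq> \<Omega>" "\<And>x. x \<notin> K \<Longrightarrow> \<zeta> x = 0"
    "\<And>x. x \<notin> K \<Longrightarrow> frechet_derivative \<zeta> (at x) = (\<lambda>_. 0)"
    by (elim test_functionE) (rule that; simp)
  have "closure {x. frechet_derivative \<zeta> (at x) b \<noteq> 0} \<subseteq> K"
    using K(4) by (intro closure_minimal compact_imp_closed[OF K(1)]) fastforce
  moreover have "Ck k (\<lambda>x. frechet_derivative \<zeta> (at x) b)" for k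
    using assms unfolding test_function_def by (metis Ck.simps(2))
  ultimately show ?thesis using K(1,2) unfolding test_function_def
    by (meson bounded_subset closed_closure compact_eq_bounded_closed order_trans)
qed

lemma test_function_bounded: "test_function \<Omega> \<zeta> \<Longrightarrow> bounded (range \<zeta>)"
proof (elim test_functionE)
  fix K assume K: "compact K" "\<And>x. x \<notin> K \<Longrightarrow> \<zeta> x = 0" "continuous_on UNIV \<zeta>"
  have "bounded (insert 0 (\<zeta> ` K))"
    using K by (auto intro!: compact_imp_bounded compact_continuous_image continuous_on_subset[OF K(3)])
  moreover have "range \<zeta> \<subseteq> insert 0 (\<zeta> ` K)" using K(2) by auto
  ultimately show ?thesis using bounded_subset by blast
qed

lemma one_plus_test_function_bounded:
  assumes "test_function \<Omega> \<zeta>" shows "\<exists>Z. \<forall>x. \<bar>1 + \<zeta> x\<bar> \<le> Z"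
  using test_function_bounded[OF assms] bounded_translation[of "range \<zeta>" 1]
  by (auto simp: bounded_iff image_image)

lemma Ck_test_function: "test_function \<Omega> \<zeta> \<Longrightarrow> Ck k \<zeta>"
  by (simp add: test_function_def)

text \<open>Admissible test functions need not vanish on the sphere, so the constant 1 may be added
  to \<zeta>. The resulting weight controls the total mass as well as the mass near the
  origin.\<close>

lemma evolution_test_stationary:
  fixes \<zeta> :: "'b::euclidean_space \<Rightarrow> real"
  assumes \<zeta>: "test_function (ball 0 R) \<zeta>"
  shows "evolution_test T R (\<lambda>_ x. 1 + \<zeta> x) (\<lambda>_ _. 0) (\<lambda>_. grad \<zeta>)"
proof -
  let ?B = "ball (0::'b) R"
  let ?d = "\<lambda>b x. frechet_derivative \<zeta> (at x) b"
  let ?dd = "\<lambda>b c x. frechet_derivative (?d b) (at x) c"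
  note d = test_function_partial[OF \<zeta>]
  note dd = test_function_partial[OF test_function_partial[OF \<zeta>]]
  have "bounded (\<Union>c\<in>Basis. range (?dd b c))" if "b \<in> Basis" for b
    using test_function_bounded[OF dd[OF that]] by auto
  \<comment> \<open>\<open>sobolev 2 (Linf_bounded C)\<close> asks for one constant serving all
    derivatives up to order two, hence the union over the finitely many basis directions.\<close>
  then have "bounded (range (\<lambda>x. 1 + \<zeta> x) \<union> (\<Union>b\<in>Basis. range (?d b)) \<union> (\<Union>b\<in>Basis. \<Union>c\<in>Basis. range (?dd b c)))"
    using test_function_bounded[OF \<zeta>] test_function_bounded[OF d]
      bounded_translation[of "range \<zeta>" 1]
    by (auto simp: image_image)
  then obtain C where C: "\<And>x. \<bar>1 + \<zeta> x\<bar> \<le> C" "\<And>b x. b \<in> Basis \<Longrightarrow> \<bar>?d b x\<bar> \<le> C"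
      "\<And>b c x. b \<in> Basis \<Longrightarrow> c \<in> Basis \<Longrightarrow> \<bar>?dd b c x\<bar> \<le> C"
    unfolding bounded_iff by (fastforce simp: real_norm_def)
  have bnd: "Linf_bounded C ?B g" if "Ck 0 g" "\<And>x. \<bar>g x\<bar> \<le> C" for g :: "'b \<Rightarrow> real"
    unfolding Linf_bounded_def using that
    by (auto intro!: borel_measurable_integrable integrable_lebesgue_on_ball AE_I2)
  have \<zeta>1: "Ck k (\<lambda>x. 1 + \<zeta> x)" for k by (intro Ck_add Ck_const Ck_test_function[OF \<zeta>])
  have wp1: "weak_partial ?B b (\<lambda>x. 1 + \<zeta> x) (?d b)" if "b \<in> Basis" for b
  proof -
    have "\<zeta> differentiable (at x)" for x using Ck_test_function[OF \<zeta>, of 1] by simp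
    then have "((\<lambda>x. 1 + \<zeta> x) has_derivative frechet_derivative \<zeta> (at x)) (at x)" for x
      by (auto intro!: derivative_eq_intros simp: frechet_derivative_works)
    then have "frechet_derivative (\<lambda>x. 1 + \<zeta> x) (at x) = frechet_derivative \<zeta> (at x)" for x
      by (metis frechet_derivative_at)
    then show ?thesis using weak_partial_C1[OF \<zeta>1 that, of ?B] by simp
  qed
  have wp2: "weak_partial ?B c (?d b) (?dd b c)" if "b \<in> Basis" "c \<in> Basis" for b c
    by (rule weak_partial_C1[OF Ck_test_function[OF d[OF that(1)]] that(2)]) auto
  have "sobolev 2 (Linf_bounded C) ?B (\<lambda>x. 1 + \<zeta> x)"
  proof -
    have "sobolev (Suc (Suc 0)) (Linf_bounded C) ?B (\<lambda>x. 1 + \<zeta> x)"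
      unfolding sobolev.simps
    proof (intro conjI ballI)
      fix b :: 'b assume b: "b \<in> Basis"
      have "\<exists>h. weak_partial ?B c (?d b) h \<and> Linf_bounded C ?B h" if c: "c \<in> Basis" for c
        using wp2[OF b c] bnd[OF Ck_test_function[OF dd[OF b c]] C(3)[OF b c]] by blast
      then show "\<exists>g. weak_partial ?B b (\<lambda>x. 1 + \<zeta> x) g \<and>
        Linf_bounded C ?B g \<and> (\<forall>ba\<in>Basis. \<exists>ga. weak_partial ?B ba g ga \<and> Linf_bounded C ?B ga)"
        using wp1[OF b] bnd[OF Ck_test_function[OF d[OF b]] C(2)[OF b]] by blast
    qed (rule bnd[OF \<zeta>1 C(1)])
    then show ?thesis by (simp add: numeral_2_eq_2)
  qed
  moreover have "weak_gradient ?B (\<lambda>x. 1 + \<zeta> x) (grad \<zeta>)"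
    unfolding weak_gradient_def using wp1 by (simp add: grad_inner)
  moreover have "Linf_on ?B (\<lambda>x. 1 + \<zeta> x)" "Linf_on ?B (\<lambda>x. 0)"
    unfolding Linf_on_def using bnd[OF \<zeta>1 C(1)] by (auto simp: Linf_bounded_def)
  ultimately show ?thesis
    unfolding evolution_test_def C1_time_Linf_def by (auto intro: exI[of _ 1])
qed

section \<open>Evolution of weighted masses\<close>

definition laplacian :: "('b::euclidean_space \<Rightarrow> real) \<Rightarrow> 'b \<Rightarrow> real" where
  "laplacian f x = (\<Sum>b\<in>Basis. frechet_derivative (\<lambda>y. frechet_derivative f (at y) b) (at x) b)"

lemma integrable_mult_bounded:
  fixes g \<eta> :: "'b \<Rightarrow> real"
  assumes "integrable M g" "\<eta> \<in> borel_measurable M" "\<And>x. x \<in> space M \<Longrightarrow> \<bar>\<eta> x\<bar> \<le> C"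
  shows "integrable M (\<lambda>x. g x * \<eta> x)"
proof (rule Bochner_Integration.integrable_bound[where f = "\<lambda>x. g x * C"])
  show "AE x in M. norm (g x * \<eta> x) \<le> norm (g x * C)"
  proof (rule AE_I2)
    fix x assume "x \<in> space M"
    from assms(3)[OF this] have "\<bar>\<eta> x\<bar> \<le> \<bar>C\<bar>" by linarith
    then show "norm (g x * \<eta> x) \<le> norm (g x * C)"
      unfolding real_norm_def abs_mult by (rule mult_left_mono) simp
  qed
qed (use assms in \<open>auto intro: borel_measurable_integrable\<close>)

text \<open>Here \<open>g\<close> is integrable only on compact subsets of \<Omega> and \<eta> may
  be unbounded near the boundary. The compact support of \<eta> reduces everything to
  \<open>K\<close>. The drift term is of this type, since the gradient of the potential is only
  known to be continuous in the open ball.\<close>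

lemma integrable_mult_continuous_support:
  fixes g \<eta> :: "'b::euclidean_space \<Rightarrow> real"
  assumes g: "locally_integrable \<Omega> g" and \<eta>: "continuous_on \<Omega> \<eta>" and \<Omega>: "\<Omega> \<in> sets lebesgue"
    and K: "compact K" "K \<subseteq> \<Omega>" "\<And>x. x \<in> \<Omega> \<Longrightarrow> x \<notin> K \<Longrightarrow> \<eta> x = 0"
  shows "integrable (lebesgue_on \<Omega>) (\<lambda>x. g x * \<eta> x)"
proof -
  have Ks: "K \<in> sets lebesgue" using K(1) by (auto intro: fmeasurableD lmeasurable_compact)
  have gi: "integrable (lebesgue_on K) g" using g K by (auto simp: locally_integrable_def)
  have \<eta>K: "continuous_on K \<eta>" using \<eta> K(2) by (rule continuous_on_subset)
  obtain C where C: "\<And>x. x \<in> K \<Longrightarrow> \<bar>\<eta> x\<bar> \<le> C"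
    using compact_imp_bounded[OF compact_continuous_image[OF \<eta>K K(1)]] by (auto simp: bounded_iff)
  have "integrable (lebesgue_on K) (\<lambda>x. g x * \<eta> x)"
    by (rule integrable_mult_bounded[OF gi
          borel_measurable_integrable[OF integrable_lebesgue_on_compact[OF K(1) \<eta>K]]])
      (use C in auto)
  then have "integrable lebesgue (\<lambda>x. if x \<in> K then g x * \<eta> x else 0)"
    by (simp add: Lebesgue_Measure.integrable_restrict_UNIV[OF Ks])
  then have "integrable (lebesgue_on \<Omega>) (\<lambda>x. if x \<in> K then g x * \<eta> x else 0)"
    using integrable_lebesgue_on_mono[of UNIV _ \<Omega>] \<Omega> by (simp add: lebesgue_on_UNIV_eq)
  then show ?thesis
    by (rule Bochner_Integration.integrable_cong[OF refl, THEN iffD1, rotated])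
      (use K(3) in \<open>auto simp: space_restrict_space\<close>)
qed

text \<open>Each first partial derivative of \<zeta> is again a test function. Inserting it into the
  definition of the weak derivative in the same direction and summing over the basis moves the
  gradient from \<open>u\<close> to \<zeta>.\<close>

lemma integral_grad_test_function:
  fixes u \<zeta> :: "'b::euclidean_space \<Rightarrow> real"
  assumes u: "weak_gradient \<Omega> u G" and \<zeta>: "test_function \<Omega> \<zeta>" and \<Omega>: "\<Omega> \<in> sets lebesgue"
  shows "integrable (lebesgue_on \<Omega>) (\<lambda>x. G x \<bullet> grad \<zeta> x)"
    and "integrable (lebesgue_on \<Omega>) (\<lambda>x. u x * laplacian \<zeta> x)"
    and "(LINT x|lebesgue_on \<Omega>. G x \<bullet> grad \<zeta> x) = - (LINT x|lebesgue_on \<Omega>. u x * laplacian \<zeta> x)"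
proof -
  let ?d = "\<lambda>b x. frechet_derivative \<zeta> (at x) b"
  let ?dd = "\<lambda>b x. frechet_derivative (?d b) (at x) b"
  note d = test_function_partial[OF \<zeta>]
  have int: "integrable (lebesgue_on \<Omega>) (\<lambda>x. g x * \<eta> x)"
    if "locally_integrable \<Omega> g" and "test_function \<Omega> \<eta>" for g \<eta>
    using that(2) by (elim test_functionE)
      (auto intro!: integrable_mult_continuous_support[OF that(1) _ \<Omega>] intro: continuous_on_subset)
  have wp: "weak_partial \<Omega> b u (\<lambda>x. G x \<bullet> b)" if "b \<in> Basis" for b
    using u that by (simp add: weak_gradient_def)
  have i1: "integrable (lebesgue_on \<Omega>) (\<lambda>x. (G x \<bullet> b) * ?d b x)" if "b \<in> Basis" for b
    by (rule int[OF _ d[OF that]]) (use wp[OF that] in \<open>simp add: weak_partial_def\<close>)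
  have i2: "integrable (lebesgue_on \<Omega>) (\<lambda>x. u x * ?dd b x)" if "b \<in> Basis" for b
    by (rule int[OF _ test_function_partial[OF d[OF that] that]]) (use wp[OF that] in \<open>simp add: weak_partial_def\<close>)
  have e1: "G x \<bullet> grad \<zeta> x = (\<Sum>b\<in>Basis. (G x \<bullet> b) * ?d b x)" for x
    by (subst euclidean_inner) (simp add: grad_inner)
  have e2: "u x * laplacian \<zeta> x = (\<Sum>b\<in>Basis. u x * ?dd b x)" for x
    by (simp add: laplacian_def sum_distrib_left)
  show "integrable (lebesgue_on \<Omega>) (\<lambda>x. G x \<bullet> grad \<zeta> x)"
    unfolding e1 by (intro Bochner_Integration.integrable_sum i1)
  show "integrable (lebesgue_on \<Omega>) (\<lambda>x. u x * laplacian \<zeta> x)"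
    unfolding e2 by (intro Bochner_Integration.integrable_sum i2)
  have "(LINT x|lebesgue_on \<Omega>. u x * ?dd b x) = - (LINT x|lebesgue_on \<Omega>. (G x \<bullet> b) * ?d b x)"
    if "b \<in> Basis" for b
    using wp[OF that] d[OF that] by (simp add: weak_partial_def)
  then show "(LINT x|lebesgue_on \<Omega>. G x \<bullet> grad \<zeta> x) = - (LINT x|lebesgue_on \<Omega>. u x * laplacian \<zeta> x)"
    unfolding e1 e2 by (simp add: Bochner_Integration.integral_sum i1 i2 flip: sum_negf)
qed

text \<open>This linear bound on the nonlinearity is what lets the diffusion term enter a Gronwall
  argument.\<close>

lemma powr_le_1_plus:
  fixes r m :: real
  assumes "0 < m" "m < 1" "0 \<le> r" shows "r powr m \<le> 1 + r"
proof (cases "r \<le> 1")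
  case True
  then show ?thesis using powr_le1[of m r] assms by simp
next
  case False
  then show ?thesis using powr_mono[of m 1 r] assms by simp
qed

text \<open>After integration by parts the diffusion contributes the integral of
  \<open>\<rho> x powr m * laplacian \<zeta> x\<close>. Since the power is nonnegative, an upper
  bound on the Laplacian suffices. The indicator confines the constant part of
  \<open>1 + \<rho> x\<close> to the ball of radius \<delta>, so the additive constant does not grow
  with \<open>R\<close>.\<close>

lemma flux_bound:
  fixes \<zeta> W \<rho> :: "'b::euclidean_space \<Rightarrow> real"
  assumes m: "0 < m" "m < 1" and W: "C1_on (ball 0 R) W"
    and \<zeta>: "test_function (ball 0 R) \<zeta>" "\<And>x. 0 \<le> \<zeta> x"
    and lap: "\<And>x. x \<in> ball 0 R \<Longrightarrow> laplacian \<zeta> x \<le> C * indicator (ball 0 \<delta>) x" and "C \<ge> 0"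
    and drift: "\<And>x. x \<in> ball 0 R \<Longrightarrow> - (grad W x \<bullet> grad \<zeta> x) \<le> A * (1 + \<zeta> x)"
    and \<rho>: "nonneg_L1 R \<rho>" and G: "weak_gradient (ball 0 R) (\<lambda>x. \<rho> x powr m) G"
  shows "- (LINT x|lebesgue_on (ball 0 R). G x \<bullet> grad \<zeta> x + \<rho> x * (grad W x \<bullet> grad \<zeta> x))
    \<le> C * measure lebesgue (ball 0 \<delta> :: 'b set) + (C + A) * (LINT x|lebesgue_on (ball 0 R). \<rho> x * (1 + \<zeta> x))"
proof -
  let ?B = "ball (0::'b) R" and ?D = "ball (0::'b) \<delta>"
  have \<rho>i: "integrable (lebesgue_on ?B) \<rho>" and \<rho>0: "AE x in lebesgue_on ?B. 0 \<le> \<rho> x"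
    using \<rho> by (auto simp: nonneg_L1_def)
  note G' = integral_grad_test_function[OF G \<zeta>(1)]
  obtain K where K: "compact K" "K \<subseteq> ?B" "\<And>x. x \<notin> K \<Longrightarrow> frechet_derivative \<zeta> (at x) = (\<lambda>_. 0)"
    "\<And>b. b \<in> Basis \<Longrightarrow> continuous_on UNIV (\<lambda>x. frechet_derivative \<zeta> (at x) b)"
    using \<zeta>(1) by (elim test_functionE) (rule that; simp)
  have "locally_integrable ?B \<rho>"
    unfolding locally_integrable_def using \<rho>i
    by (auto intro!: integrable_lebesgue_on_mono[of ?B] intro: fmeasurableD[OF lmeasurable_compact])
  moreover have "continuous_on ?B (\<lambda>x. grad W x \<bullet> grad \<zeta> x)"
    using W K(4) unfolding C1_on_def grad_def[of \<zeta>]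
    by (auto intro!: continuous_intros intro: continuous_on_subset)
  ultimately have i3: "integrable (lebesgue_on ?B) (\<lambda>x. \<rho> x * (grad W x \<bullet> grad \<zeta> x))"
    by (rule integrable_mult_continuous_support[OF _ _ _ K(1,2)]) (use K(3) in \<open>auto simp: grad_def\<close>)
  obtain Z where Z: "\<And>x. \<bar>1 + \<zeta> x\<bar> \<le> Z"
    using one_plus_test_function_bounded[OF \<zeta>(1)] by blast
  have i4: "integrable (lebesgue_on ?B) (\<lambda>x. \<rho> x * (1 + \<zeta> x))"
    by (rule integrable_mult_bounded[OF \<rho>i borel_measurable_integrable[OF integrable_lebesgue_on_ball] Z])
      (use Ck_test_function[OF \<zeta>(1), of 0] in \<open>simp add: continuous_on_add\<close>)
  have iD: "integrable lebesgue (indicator ?D :: 'b \<Rightarrow> real)"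
    by (intro integrable_real_indicator) (use emeasure_bounded_finite[OF bounded_ball] in auto)
  have i5: "integrable (lebesgue_on ?B) (indicator ?D :: 'b \<Rightarrow> real)"
    by (rule integrable_lebesgue_on_mono[of UNIV]) (use iD in \<open>simp_all add: lebesgue_on_UNIV_eq\<close>)
  have "- (LINT x|lebesgue_on ?B. G x \<bullet> grad \<zeta> x + \<rho> x * (grad W x \<bullet> grad \<zeta> x))
      = (LINT x|lebesgue_on ?B. \<rho> x powr m * laplacian \<zeta> x - \<rho> x * (grad W x \<bullet> grad \<zeta> x))"
    using G' i3 by simp
  also have "\<dots> \<le> (LINT x|lebesgue_on ?B. C * indicator ?D x + (C + A) * (\<rho> x * (1 + \<zeta> x)))"
  proof (rule integral_mono_AE)
    show "AE x in lebesgue_on ?B. \<rho> x powr m * laplacian \<zeta> x - \<rho> x * (grad W x \<bullet> grad \<zeta> x)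
        \<le> C * indicator ?D x + (C + A) * (\<rho> x * (1 + \<zeta> x))"
      using \<rho>0 AE_space
    proof eventually_elim
      case (elim x)
      then have x: "x \<in> ?B" by simp
      let ?I = "indicator ?D x :: real"
      have I: "0 \<le> ?I" "?I \<le> 1" by (auto simp: indicator_def)
      \<comment> \<open>The summand 1 in the weight absorbs the indicator multiplying
        \<rho>.\<close>
      then have I': "?I \<le> 1 + \<zeta> x" using \<zeta>(2)[of x] by linarith
      have "\<rho> x powr m * laplacian \<zeta> x \<le> \<rho> x powr m * (C * ?I)"
        by (intro mult_left_mono lap x) simp
      also have "\<dots> \<le> (1 + \<rho> x) * (C * ?I)"
        using powr_le_1_plus[OF m elim(1)] \<open>C \<ge> 0\<close> I by (intro mult_right_mono) auto
      also have "\<dots> = C * ?I + \<rho> x * C * ?I" by (simp add: algebra_simps)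
      also have "\<rho> x * C * ?I \<le> \<rho> x * C * (1 + \<zeta> x)"
        using I' elim(1) \<open>C \<ge> 0\<close> by (intro mult_left_mono) auto
      finally have 1: "\<rho> x powr m * laplacian \<zeta> x \<le> C * ?I + \<rho> x * C * (1 + \<zeta> x)" by simp
      have "\<rho> x * (- (grad W x \<bullet> grad \<zeta> x)) \<le> \<rho> x * (A * (1 + \<zeta> x))"
        by (intro mult_left_mono drift x elim)
      with 1 show ?case by (simp add: algebra_simps)
    qed
  qed (use G' i3 i4 i5 in auto)
  also have "\<dots> = C * (LINT x|lebesgue_on ?B. indicator ?D x) + (C + A) * (LINT x|lebesgue_on ?B. \<rho> x * (1 + \<zeta> x))"
    using i4 i5 by simp
  also have "(LINT x|lebesgue_on ?B. indicator ?D x) \<le> (LINT x|lebesgue_on UNIV. indicator ?D x :: real)"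
    by (rule integral_mono_lebesgue_on_AE) (use iD in \<open>simp_all add: lebesgue_on_UNIV_eq\<close>)
  also have "\<dots> = measure lebesgue ?D" by (simp add: lebesgue_on_UNIV_eq)
  finally show ?thesis using \<open>C \<ge> 0\<close> by (simp add: mult_left_mono)
qed

lemma nonneg_L1_regular_datum:
  fixes f :: "'b::euclidean_space \<Rightarrow> real"
  assumes "regular_datum R f" shows "nonneg_L1 R f"
proof -
  from assms obtain \<epsilon> where \<epsilon>: "\<epsilon> > 0" and ae: "AE x in lebesgue_on (ball 0 R). \<epsilon> \<le> f x \<and> f x \<le> 1 / \<epsilon>"
    unfolding regular_datum_def by blast
  have meas: "f \<in> borel_measurable (lebesgue_on (ball 0 R))"
    using assms by (simp add: regular_datum_def L2_on_def)
  interpret finite_measure "lebesgue_on (ball (0::'b) R)" by (rule finite_measure_lebesgue_on) auto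
  have "integrable (lebesgue_on (ball 0 R)) f"
  proof (rule integrable_const_bound[OF _ meas])
    show "AE x in lebesgue_on (ball 0 R). norm (f x) \<le> 1 / \<epsilon>"
      using ae by eventually_elim (use \<epsilon> in auto)
  qed
  moreover have "AE x in lebesgue_on (ball 0 R). 0 \<le> f x" using ae by eventually_elim (use \<epsilon> in auto)
  ultimately show ?thesis by (simp add: nonneg_L1_def)
qed

text \<open>Stated for an arbitrary filter: it serves both for continuity in time of the weighted
  mass and for the passage from regular data to general data.\<close>

lemma tendsto_integral_mult_bounded:
  fixes g \<Phi> :: "'b \<Rightarrow> real"
  assumes lim: "((\<lambda>i. LINT x|M. \<bar>s i x - g x\<bar>) \<longlongrightarrow> 0) F"
    and s: "\<forall>\<^sub>F i in F. integrable M (s i)" and g: "integrable M g"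
    and \<Phi>: "\<Phi> \<in> borel_measurable M" "\<And>x. \<bar>\<Phi> x\<bar> \<le> Z"
  shows "((\<lambda>i. LINT x|M. s i x * \<Phi> x) \<longlongrightarrow> (LINT x|M. g x * \<Phi> x)) F"
proof (rule LIM_zero_cancel, rule Lim_null_comparison[where g = "\<lambda>i. Z * (LINT x|M. \<bar>s i x - g x\<bar>)"])
  show "((\<lambda>i. Z * (LINT x|M. \<bar>s i x - g x\<bar>)) \<longlongrightarrow> 0) F"
    using tendsto_mult_right_zero[OF lim, of Z] by simp
  show "\<forall>\<^sub>F i in F. norm ((LINT x|M. s i x * \<Phi> x) - (LINT x|M. g x * \<Phi> x)) \<le> Z * (LINT x|M. \<bar>s i x - g x\<bar>)"
    using s
  proof eventually_elim
    case (elim i)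
    note int = integrable_mult_bounded[OF _ \<Phi>(1), of _ Z]
    have "(LINT x|M. s i x * \<Phi> x) - (LINT x|M. g x * \<Phi> x) = (LINT x|M. (s i x - g x) * \<Phi> x)"
      using int[OF elim \<Phi>(2)] int[OF g \<Phi>(2)] by (simp add: left_diff_distrib)
    also have "norm \<dots> \<le> (LINT x|M. \<bar>(s i x - g x) * \<Phi> x\<bar>)"
      using integral_norm_bound[of M "\<lambda>x. (s i x - g x) * \<Phi> x"] by simp
    also have "\<dots> \<le> (LINT x|M. Z * \<bar>s i x - g x\<bar>)"
    proof (rule integral_mono)
      show "integrable M (\<lambda>x. \<bar>(s i x - g x) * \<Phi> x\<bar>)"
        by (intro integrable_abs int Bochner_Integration.integrable_diff elim g \<Phi>(2))
      show "\<bar>(s i x - g x) * \<Phi> x\<bar> \<le> Z * \<bar>s i x - g x\<bar>" for x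
        using mult_right_mono[OF \<Phi>(2)[of x] abs_ge_zero[of "s i x - g x"]] by (simp add: abs_mult mult.commute)
    qed (use elim g in auto)
    finally show ?case by simp
  qed
qed

text \<open>Testing with the stationary weight \<open>1 + \<zeta>\<close> expresses the weighted
  mass as its initial value minus the time integral of the flux. The flux bound then gives the
  hypothesis of Gronwall's inequality.\<close>

lemma weighted_mass_bound_regular:
  fixes \<zeta> W :: "'b::euclidean_space \<Rightarrow> real"
  assumes m: "0 < m" "m < 1" and W: "C1_on (ball 0 R) W"
    and \<zeta>: "test_function (ball 0 R) \<zeta>" "\<And>x. 0 \<le> \<zeta> x"
    and lap: "\<And>x. x \<in> ball 0 R \<Longrightarrow> laplacian \<zeta> x \<le> C * indicator (ball 0 \<delta>) x" and "C \<ge> 0" "C + A > 0"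
    and drift: "\<And>x. x \<in> ball 0 R \<Longrightarrow> - (grad W x \<bullet> grad \<zeta> x) \<le> A * (1 + \<zeta> x)"
    and \<rho>: "regular_solution m R W f \<rho>" "\<And>t. t \<ge> 0 \<Longrightarrow> nonneg_L1 R (\<rho> t)" and t: "t > 0"
  shows "(LINT x|lebesgue_on (ball 0 R). \<rho> t x * (1 + \<zeta> x))
    \<le> ((LINT x|lebesgue_on (ball 0 R). f x * (1 + \<zeta> x)) + C * measure lebesgue (ball 0 \<delta> :: 'b set) / (C + A))
        * exp ((C + A) * t)"
proof -
  let ?B = "ball (0::'b) R"
  define a where "a = C * measure lebesgue (ball 0 \<delta> :: 'b set)"
  define k where "k = C + A"
  define y where "y s = (LINT x|lebesgue_on ?B. \<rho> s x * (1 + \<zeta> x))" for s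
  have ak: "a \<ge> 0" "k > 0" using assms by (auto simp: a_def k_def)
  obtain Z where Z: "\<And>x. \<bar>1 + \<zeta> x\<bar> \<le> Z"
    using one_plus_test_function_bounded[OF \<zeta>(1)] by blast
  have \<zeta>m: "(\<lambda>x. 1 + \<zeta> x) \<in> borel_measurable (lebesgue_on ?B)"
    by (rule borel_measurable_integrable[OF integrable_lebesgue_on_ball])
      (use Ck_test_function[OF \<zeta>(1), of 0] in \<open>simp add: continuous_on_add\<close>)
  have yc: "continuous_on {0..} y"
    unfolding continuous_on_def
  proof
    fix s :: real assume s: "s \<in> {0..}"
    have "\<forall>\<^sub>F u in at s within {0..}. integrable (lebesgue_on ?B) (\<rho> u)"
      using \<rho>(2) by (auto simp: eventually_at_filter nonneg_L1_def)
    then show "(y \<longlongrightarrow> y s) (at s within {0..})"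
      unfolding y_def using s \<rho>(1)
      by (intro tendsto_integral_mult_bounded[OF _ _ _ \<zeta>m Z]) (auto simp: regular_solution_def)
  qed
  have y0: "y s \<ge> 0" if "s \<ge> 0" for s
    unfolding y_def
  proof (rule integral_nonneg_AE)
    have "AE x in lebesgue_on ?B. 0 \<le> \<rho> s x" using \<rho>(2)[OF that] by (simp add: nonneg_L1_def)
    then show "AE x in lebesgue_on ?B. 0 \<le> \<rho> s x * (1 + \<zeta> x)"
      by eventually_elim (simp add: \<zeta>(2) add_nonneg_nonneg)
  qed
  have "y t \<le> ((LINT x|lebesgue_on ?B. f x * (1 + \<zeta> x)) + a / k) * exp (k * t) - a / k"
  proof (rule gronwall_AE[OF yc ak(2) _ t])
    fix T :: real assume T: "T > 0"
    from \<rho>(1) T have "weak_L1_solution m R W T f \<rho>" by (simp add: regular_solution_def)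
    then obtain G where G: "AE s in lebesgue_on {0<..<T}. weak_gradient ?B (\<lambda>x. \<rho> s x powr m) (G s)"
      and eq: "\<And>\<phi> \<phi>t D\<phi>. evolution_test T R \<phi> \<phi>t D\<phi> \<Longrightarrow>
          (AE t in lebesgue_on {0<..<T}.
             (LINT x|lebesgue_on ?B. \<rho> t x * \<phi> t x)
             - (LINT s|lebesgue_on {0<..<t}. LINT x|lebesgue_on ?B. \<rho> s x * \<phi>t s x)
             = - (LINT s|lebesgue_on {0<..<t}. LINT x|lebesgue_on ?B.
                    G s x \<bullet> D\<phi> s x + \<rho> s x * (grad W x \<bullet> D\<phi> s x))
               + (LINT x|lebesgue_on ?B. f x * \<phi> 0 x))"
      unfolding weak_L1_solution_def by blast
    define H where "H s = (LINT x|lebesgue_on ?B. G s x \<bullet> grad \<zeta> x + \<rho> s x * (grad W x \<bullet> grad \<zeta> x))" for s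
    have H: "AE s in lebesgue_on {0<..<T}. - H s \<le> a + k * y s"
      using G AE_space
    proof eventually_elim
      case (elim s)
      then show ?case unfolding H_def a_def k_def y_def
        by (intro flux_bound[OF m W \<zeta> lap \<open>C \<ge> 0\<close> drift]) (auto intro: \<rho>(2))
    qed
    from eq[OF evolution_test_stationary[OF \<zeta>(1)]]
    have "AE t in lebesgue_on {0<..<T}. y t = - (LINT s|lebesgue_on {0<..<t}. H s)
        + (LINT x|lebesgue_on ?B. f x * (1 + \<zeta> x))"
      by (simp add: y_def H_def)
    then show "AE t in lebesgue_on {0<..<T}. y t \<le> (LINT x|lebesgue_on ?B. f x * (1 + \<zeta> x))
        + (LINT s|lebesgue_on {0<..<t}. a + k * y s)"
      using AE_space
    proof eventually_elim
      case (elim t)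
      then have t: "0 < t" "t < T" by auto
      have "(LINT s|lebesgue_on {0<..<t}. - H s) \<le> (LINT s|lebesgue_on {0<..<t}. a + k * y s)"
      \<comment> \<open>This rule asks for integrability of the upper bound only. Nonnegativity of
        that bound covers the default value 0 of the integral in case \<open>- H\<close> is not
        integrable.\<close>
      proof (rule integral_mono_AE')
        have "continuous_on {0..t} (\<lambda>s. a + k * y s)"
          by (intro continuous_intros continuous_on_subset[OF yc]) auto
        then show "integrable (lebesgue_on {0<..<t}) (\<lambda>s. a + k * y s)"
          by (intro integrable_lebesgue_on_mono[OF integrable_lebesgue_on_compact[of "{0..t}"]]) auto
        show "AE s in lebesgue_on {0<..<t}. - H s \<le> a + k * y s"
          using H t by (auto simp: AE_restrict_space_iff elim!: eventually_mono)
        show "AE s in lebesgue_on {0<..<t}. 0 \<le> a + k * y s"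
          using ak y0 by (intro AE_I2) auto
      qed
      then show ?case using elim(1) by simp
    qed
  qed
  moreover have "a / k \<ge> 0" using ak by simp
  ultimately show ?thesis unfolding y_def a_def k_def by linarith
qed

text \<open>Because the weight is bounded, both sides are continuous in the L1 norm of the datum:
  the right one directly, the left one through the continuity built into the solution operator. The
  estimate therefore passes to the limit from regular data.\<close>

lemma weighted_mass_bound:
  fixes \<zeta> W f :: "'b::euclidean_space \<Rightarrow> real"
  assumes m: "0 < m" "m < 1" and W: "C1_on (ball 0 R) W"
    and \<zeta>: "test_function (ball 0 R) \<zeta>" "\<And>x. 0 \<le> \<zeta> x"
    and lap: "\<And>x. x \<in> ball 0 R \<Longrightarrow> laplacian \<zeta> x \<le> C * indicator (ball 0 \<delta>) x" and C: "C \<ge> 0" "C + A > 0"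
    and drift: "\<And>x. x \<in> ball 0 R \<Longrightarrow> - (grad W x \<bullet> grad \<zeta> x) \<le> A * (1 + \<zeta> x)"
    and S: "solution_operator m R W S" and f: "nonneg_L1 R f" and t: "t > 0"
  shows "(LINT x|lebesgue_on (ball 0 R). S t f x * (1 + \<zeta> x))
    \<le> ((LINT x|lebesgue_on (ball 0 R). f x * (1 + \<zeta> x)) + C * measure lebesgue (ball 0 \<delta> :: 'b set) / (C + A))
        * exp ((C + A) * t)"
proof -
  let ?M = "lebesgue_on (ball (0::'b) R)"
  have "\<exists>g. regular_datum R g \<and> (LINT x|?M. \<bar>g x - f x\<bar>) < inverse (real (Suc k))" for k
    using regular_datum_dense[OF f, of "inverse (real (Suc k))"] by auto
  then obtain g where g: "\<And>k. regular_datum R (g k)" "\<And>k. (LINT x|?M. \<bar>g k x - f x\<bar>) < inverse (real (Suc k))"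
    by metis
  have gn: "nonneg_L1 R (g k)" for k by (rule nonneg_L1_regular_datum[OF g(1)])
  have lim: "(\<lambda>k. LINT x|?M. \<bar>g k x - f x\<bar>) \<longlonglongrightarrow> 0"
    by (rule tendsto_sandwich[OF _ _ tendsto_const LIMSEQ_inverse_real_of_nat])
      (simp_all add: less_imp_le[OF g(2)] del: of_nat_Suc)
  have "\<forall>t\<ge>0. \<forall>f fs. nonneg_L1 R f \<and> (\<forall>k::nat. nonneg_L1 R (fs k)) \<and>
      (\<lambda>k. LINT x|?M. \<bar>fs k x - f x\<bar>) \<longlonglongrightarrow> 0 \<longrightarrow>
      (\<lambda>k. LINT x|?M. \<bar>S t (fs k) x - S t f x\<bar>) \<longlonglongrightarrow> 0"
    using S unfolding solution_operator_def by (elim conjE)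
  from this[rule_format, of t f g] have limS: "(\<lambda>k. LINT x|?M. \<bar>S t (g k) x - S t f x\<bar>) \<longlonglongrightarrow> 0"
    using f gn lim t by simp
  have Sn: "nonneg_L1 R (S s h)" if "s \<ge> 0" "nonneg_L1 R h" for s h
    using S that unfolding solution_operator_def by blast
  obtain Z where Z: "\<And>x. \<bar>1 + \<zeta> x\<bar> \<le> Z"
    using one_plus_test_function_bounded[OF \<zeta>(1)] by blast
  have \<zeta>m: "(\<lambda>x. 1 + \<zeta> x) \<in> borel_measurable ?M"
    by (rule borel_measurable_integrable[OF integrable_lebesgue_on_ball])
      (use Ck_test_function[OF \<zeta>(1), of 0] in \<open>simp add: continuous_on_add\<close>)
  note tend = tendsto_integral_mult_bounded[OF _ _ _ \<zeta>m Z]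
  show ?thesis
  proof (rule LIMSEQ_le)
    show "(\<lambda>k. LINT x|?M. S t (g k) x * (1 + \<zeta> x)) \<longlonglongrightarrow> (LINT x|?M. S t f x * (1 + \<zeta> x))"
      by (rule tend[OF limS]) (use Sn gn f t in \<open>auto simp: nonneg_L1_def\<close>)
    have "(\<lambda>k. LINT x|?M. g k x * (1 + \<zeta> x)) \<longlonglongrightarrow> (LINT x|?M. f x * (1 + \<zeta> x))"
      by (rule tend[OF lim]) (use gn f in \<open>auto simp: nonneg_L1_def\<close>)
    then show "(\<lambda>k. ((LINT x|?M. g k x * (1 + \<zeta> x)) + C * measure lebesgue (ball 0 \<delta> :: 'b set) / (C + A))
        * exp ((C + A) * t)) \<longlonglongrightarrow> ((LINT x|?M. f x * (1 + \<zeta> x)) + C * measure lebesgue (ball 0 \<delta> :: 'b set) / (C + A))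
        * exp ((C + A) * t)"
      by (intro tendsto_intros)
    show "\<exists>N. \<forall>k\<ge>N. (LINT x|?M. S t (g k) x * (1 + \<zeta> x))
      \<le> ((LINT x|?M. g k x * (1 + \<zeta> x)) + C * measure lebesgue (ball 0 \<delta> :: 'b set) / (C + A)) * exp ((C + A) * t)"
    proof (intro exI allI impI)
      fix k
      have "regular_solution m R W (g k) (\<lambda>t. S t (g k))"
        using S g(1) unfolding solution_operator_def by blast
      then show "(LINT x|?M. S t (g k) x * (1 + \<zeta> x))
        \<le> ((LINT x|?M. g k x * (1 + \<zeta> x)) + C * measure lebesgue (ball 0 \<delta> :: 'b set) / (C + A)) * exp ((C + A) * t)"
        using weighted_mass_bound_regular[OF m W \<zeta> lap C drift, of "g k" "\<lambda>t. S t (g k)" t]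
        by (simp add: Sn gn t)
    qed
  qed
qed

section \<open>A barrier singular at the origin as \<open>\<epsilon> \<rightarrow> 0\<close>\<close>

lemma flat_powr_nonneg: "0 \<le> flat_powr a s"
  by (simp add: flat_powr_def)

lemma flat_powr_nonpos_arg: "s \<le> 0 \<Longrightarrow> flat_powr a s = 0"
  by (simp add: flat_powr_def)

lemma flat_powr_1_le: "0 \<le> s \<Longrightarrow> flat_powr 1 s \<le> s"
  by (cases "s = 0") (auto simp: flat_powr_def mult_left_le)

text \<open>For \<open>s > 1\<close> the exponential factor is at least \<open>exp (- 1)\<close>, so
  the profile grows linearly. This is used twice: to control the drift by the weight, and to make
  the weight large near the origin.\<close>

lemma le_flat_powr_1: "s \<le> 1 + exp 1 * flat_powr 1 s"
proof (cases "s \<le> 1")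
  case True
  then show ?thesis using flat_powr_nonneg[of 1 s] by (simp add: add_increasing2)
next
  case False
  then have "exp (- 1) \<le> exp (- 1 / s\<^sup>2)" by (simp add: one_le_power)
  then have "s * exp (- 1) \<le> flat_powr 1 s" using False by (simp add: flat_powr_def)
  then have "exp 1 * (s * exp (- 1)) \<le> exp 1 * flat_powr 1 s" by simp
  moreover have "exp 1 * (s * exp (- 1)) = s" by (simp add: exp_minus)
  ultimately show ?thesis by simp
qed

text \<open>\<open>flat_deriv\<close> and \<open>flat_deriv2\<close> are the first and second
  derivatives of the profile \<open>flat_powr 1\<close>, expressed within the damped powers.\<close>

definition flat_deriv :: "real \<Rightarrow> real" where
  "flat_deriv s = flat_powr 0 s + 2 * flat_powr (- 2) s"

definition flat_deriv2 :: "real \<Rightarrow> real" where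
  "flat_deriv2 s = 4 * flat_powr (- 5) s - 2 * flat_powr (- 3) s"

lemma has_derivative_flat_powr_1: "(flat_powr 1 has_real_derivative flat_deriv s) (at s)"
  using has_real_derivative_flat_powr[of 1 s] by (simp add: flat_deriv_def)

lemma has_derivative_flat_deriv: "(flat_deriv has_real_derivative flat_deriv2 s) (at s)"
proof -
  have "(flat_deriv has_real_derivative
      (0 * flat_powr (0 - 1) s + 2 * flat_powr (0 - 3) s)
      + 2 * (- 2 * flat_powr (- 2 - 1) s + 2 * flat_powr (- 2 - 3) s)) (at s)"
    unfolding flat_deriv_def[abs_def]
    by (intro DERIV_add DERIV_cmult has_real_derivative_flat_powr)
  then show ?thesis by (simp add: flat_deriv2_def algebra_simps)
qed

text \<open>With \<open>u = 1 / s\<^sup>2\<close> the derivative for \<open>s > 0\<close> is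
  \<open>(1 + 2 * u) * exp (- u)\<close>, and \<open>1 + u \<le> exp u\<close> bounds it by
  2.\<close>

lemma flat_deriv_bounds: "0 \<le> flat_deriv s" "flat_deriv s \<le> 2"
proof -
  show "0 \<le> flat_deriv s" using flat_powr_nonneg by (simp add: flat_deriv_def)
  show "flat_deriv s \<le> 2"
  proof (cases "s > 0")
    case True
    have "1 + 2 * (1 / s\<^sup>2) \<le> 2 * (1 + 1 / s\<^sup>2)" by simp
    also have "\<dots> \<le> 2 * exp (1 / s\<^sup>2)" by (intro mult_left_mono exp_ge_add_one_self) auto
    finally have "(1 + 2 * (1 / s\<^sup>2)) * exp (- 1 / s\<^sup>2) \<le> 2 * exp (1 / s\<^sup>2) * exp (- 1 / s\<^sup>2)"
      by (intro mult_right_mono) auto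
    also have "\<dots> = 2" by (simp add: exp_minus flip: exp_add)
    finally show ?thesis
      using True by (simp add: flat_deriv_def flat_powr_def powr_minus powr_numeral field_simps)
  qed (simp add: flat_deriv_def flat_powr_nonpos_arg)
qed

text \<open>For \<open>s > 0\<close> the second derivative is
  \<open>(4 - 2 * s\<^sup>2) * flat_powr (- 5) s\<close>, which is nonpositive as soon as
  \<open>s\<^sup>2 \<ge> 2\<close>; the threshold 2 leaves room. On the remaining compact interval
  continuity gives a bound.\<close>

lemma flat_deriv2_bound:
  obtains B where "B \<ge> 0" "\<And>s. flat_deriv2 s \<le> B" "\<And>s. s > 2 \<Longrightarrow> flat_deriv2 s \<le> 0"
proof -
  have "continuous_on {0..2} (flat_powr (- 5))"
    using Ck_flat_powr[of 0] by (auto intro: continuous_on_subset)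
  then have "bounded (flat_powr (- 5) ` {0..2})"
    by (intro compact_imp_bounded compact_continuous_image) auto
  then obtain B where B: "\<And>s. s \<in> {0..2} \<Longrightarrow> \<bar>flat_powr (- 5) s\<bar> \<le> B"
    unfolding bounded_iff by (metis imageI real_norm_def)
  have B0: "B \<ge> 0" using B[of 0] by simp
  have neg: "flat_deriv2 s \<le> 0" if "s > 2" for s
  proof -
    have "flat_powr (- 3) s = s\<^sup>2 * flat_powr (- 5) s"
      using that powr_add[of s 2 "- 5"] by (simp add: flat_powr_def powr_numeral)
    moreover have "4 \<le> s\<^sup>2" using that by (simp add: power2_eq_square mult_mono[of 2 s 2 s, simplified])
    then have "4 * flat_powr (- 5) s \<le> s\<^sup>2 * flat_powr (- 5) s"
      by (intro mult_right_mono flat_powr_nonneg)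
    ultimately show ?thesis
      using flat_powr_nonneg[of "- 5" s] flat_powr_nonneg[of "- 3" s] by (simp add: flat_deriv2_def)
  qed
  have "flat_deriv2 s \<le> 4 * B" for s
  proof -
    consider "s > 2" | "s \<in> {0..2}" | "s \<le> 0" by fastforce
    then show ?thesis
    proof cases
      case 1
      then show ?thesis using neg[of s] B0 by simp
    next
      case 2
      then show ?thesis using B[OF 2] flat_powr_nonneg[of "- 3" s] by (simp add: flat_deriv2_def)
    next
      case 3
      then show ?thesis using B0 by (simp add: flat_deriv2_def flat_powr_nonpos_arg)
    qed
  qed
  then show ?thesis using that[of "4 * B"] B0 neg by simp
qed

section \<open>Regularised inverse distance and the weight built from it\<close>

definition inv_dist :: "real \<Rightarrow> 'b::euclidean_space \<Rightarrow> real" where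
  "inv_dist \<epsilon> x = (\<epsilon>\<^sup>2 + x \<bullet> x) powr (- 1 / 2)"

text \<open>Subtracting \<kappa> cuts the weight off at radius \<open>1 / \<kappa>\<close>, while
  \<epsilon> keeps it smooth at the origin.\<close>

definition barrier :: "real \<Rightarrow> real \<Rightarrow> 'b::euclidean_space \<Rightarrow> real" where
  "barrier \<epsilon> \<kappa> x = flat_powr 1 (inv_dist \<epsilon> x - \<kappa>)"

context
  fixes \<epsilon> \<kappa> :: real
  assumes \<epsilon>: "\<epsilon> > 0" and \<kappa>: "\<kappa> > 0"
begin

lemma inv_dist_pos: "inv_dist \<epsilon> (x::'b::euclidean_space) > 0"
proof -
  have "\<epsilon>\<^sup>2 + x \<bullet> x > 0" using \<epsilon> by (simp add: add_pos_nonneg)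
  then show ?thesis unfolding inv_dist_def by (metis less_irrefl powr_gt_zero)
qed

text \<open>The size estimates below start from this algebraic relation instead of from
  \<open>powr\<close>.\<close>

lemma inv_dist_square: "(inv_dist \<epsilon> (x::'b::euclidean_space))\<^sup>2 * (\<epsilon>\<^sup>2 + x \<bullet> x) = 1"
proof -
  have "\<epsilon>\<^sup>2 + x \<bullet> x > 0" using \<epsilon> by (simp add: add_pos_nonneg)
  moreover from this have "(inv_dist \<epsilon> x)\<^sup>2 = (\<epsilon>\<^sup>2 + x \<bullet> x) powr (- 1)"
    by (simp add: inv_dist_def powr_power)
  ultimately show ?thesis by (simp add: powr_minus)
qed

lemma inv_dist_square_norm: "(inv_dist \<epsilon> (x::'b::euclidean_space))\<^sup>2 * (x \<bullet> x) \<le> 1"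
proof -
  have "(inv_dist \<epsilon> x)\<^sup>2 * (x \<bullet> x) \<le> (inv_dist \<epsilon> x)\<^sup>2 * (\<epsilon>\<^sup>2 + x \<bullet> x)"
    by (intro mult_left_mono) auto
  then show ?thesis by (simp add: inv_dist_square)
qed

lemma inv_dist_le: "inv_dist \<epsilon> (x::'b::euclidean_space) * norm x \<le> 1" "\<epsilon> * inv_dist \<epsilon> x \<le> 1"
proof -
  have "(inv_dist \<epsilon> x * norm x)\<^sup>2 \<le> 1\<^sup>2"
    using inv_dist_square_norm[of x] by (simp add: power_mult_distrib dot_square_norm)
  then show "inv_dist \<epsilon> x * norm x \<le> 1" by (rule power2_le_imp_le) simp
  have "(inv_dist \<epsilon> x)\<^sup>2 * \<epsilon>\<^sup>2 \<le> (inv_dist \<epsilon> x)\<^sup>2 * (\<epsilon>\<^sup>2 + x \<bullet> x)"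
    by (intro mult_left_mono) auto
  then have "(\<epsilon> * inv_dist \<epsilon> x)\<^sup>2 \<le> 1\<^sup>2" by (simp add: inv_dist_square power_mult_distrib mult.commute)
  then show "\<epsilon> * inv_dist \<epsilon> x \<le> 1" by (rule power2_le_imp_le) simp
qed

text \<open>Writing the derivative through the cube of \<open>inv_dist\<close> keeps all further
  derivatives polynomial in that function and in \<open>x\<close>.\<close>

lemma has_derivative_inv_dist:
  "(inv_dist \<epsilon> has_derivative (\<lambda>h. - ((inv_dist \<epsilon> x) ^ 3 * (x \<bullet> h)))) (at (x::'b::euclidean_space))"
proof -
  have pos: "\<epsilon>\<^sup>2 + x \<bullet> x > 0" using \<epsilon> by (simp add: add_pos_nonneg)
  have "(inv_dist \<epsilon> x) ^ 3 = (\<epsilon>\<^sup>2 + x \<bullet> x) powr (- 1 / 2 - 1)"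
    using pos by (simp add: inv_dist_def powr_power)
  moreover have "(\<epsilon>\<^sup>2 + x \<bullet> x) powr (- (3 / 2)) = (\<epsilon>\<^sup>2 + x \<bullet> x) powr (- (1 / 2)) / (\<epsilon>\<^sup>2 + x \<bullet> x)"
    using pos powr_diff[of "\<epsilon>\<^sup>2 + x \<bullet> x" "- (1 / 2)" 1] by simp
  ultimately show ?thesis
    unfolding inv_dist_def[abs_def] using pos
    by (auto intro!: derivative_eq_intros simp: fun_eq_iff inner_commute)
qed

lemma barrier_nonneg: "0 \<le> barrier \<epsilon> \<kappa> x"
  by (simp add: barrier_def flat_powr_nonneg)

lemma has_derivative_barrier:
  fixes x :: "'b::euclidean_space"
  shows "(barrier \<epsilon> \<kappa> has_derivative
    (\<lambda>h. - flat_deriv (inv_dist \<epsilon> x - \<kappa>) * (inv_dist \<epsilon> x) ^ 3 * (x \<bullet> h))) (at x)"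
proof -
  have "((\<lambda>x. inv_dist \<epsilon> x - \<kappa>) has_derivative (\<lambda>h. - ((inv_dist \<epsilon> x) ^ 3 * (x \<bullet> h)))) (at x)"
    using has_derivative_diff[OF has_derivative_inv_dist[of x] has_derivative_const[of \<kappa>]] by simp
  from has_derivative_compose[OF this has_derivative_flat_powr_1[unfolded has_field_derivative_def]]
  show ?thesis by (simp add: barrier_def[abs_def] algebra_simps)
qed

lemma frechet_derivative_barrier:
  "frechet_derivative (barrier \<epsilon> \<kappa>) (at (x::'b::euclidean_space)) =
    (\<lambda>h. - flat_deriv (inv_dist \<epsilon> x - \<kappa>) * (inv_dist \<epsilon> x) ^ 3 * (x \<bullet> h))"
  using frechet_derivative_at[OF has_derivative_barrier] by metis

lemma grad_barrier:
  "grad (barrier \<epsilon> \<kappa>) (x::'b::euclidean_space) =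
    - (flat_deriv (inv_dist \<epsilon> x - \<kappa>) * (inv_dist \<epsilon> x) ^ 3) *\<^sub>R x"
  by (rule euclidean_eqI) (simp add: grad_inner frechet_derivative_barrier)

lemma second_derivative_barrier:
  fixes x b h :: "'b::euclidean_space"
  defines "q \<equiv> inv_dist \<epsilon> x"
  shows "frechet_derivative (\<lambda>y. frechet_derivative (barrier \<epsilon> \<kappa>) (at y) b) (at x) h =
    flat_deriv2 (q - \<kappa>) * q ^ 6 * ((x \<bullet> h) * (x \<bullet> b))
      + flat_deriv (q - \<kappa>) * (3 * q ^ 5 * ((x \<bullet> h) * (x \<bullet> b)) - q ^ 3 * (h \<bullet> b))"
proof -
  have 1: "((\<lambda>y. flat_deriv (inv_dist \<epsilon> y - \<kappa>)) has_derivative (\<lambda>h. flat_deriv2 (q - \<kappa>) * (- (q ^ 3 * (x \<bullet> h))))) (at x)"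
    unfolding q_def
    using has_derivative_compose[OF has_derivative_diff[OF has_derivative_inv_dist[of x] has_derivative_const[of \<kappa>]]
      has_derivative_flat_deriv[unfolded has_field_derivative_def]] by simp
  have "((\<lambda>y. - flat_deriv (inv_dist \<epsilon> y - \<kappa>) * (inv_dist \<epsilon> y) ^ 3 * (y \<bullet> b)) has_derivative
    (\<lambda>h. flat_deriv2 (q - \<kappa>) * q ^ 6 * ((x \<bullet> h) * (x \<bullet> b))
      + flat_deriv (q - \<kappa>) * (3 * q ^ 5 * ((x \<bullet> h) * (x \<bullet> b)) - q ^ 3 * (h \<bullet> b)))) (at x)"
    by (auto intro!: derivative_eq_intros 1 has_derivative_inv_dist
      simp: fun_eq_iff q_def[symmetric] algebra_simps eval_nat_numeral)
  from frechet_derivative_at[OF this, symmetric] show ?thesis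
    unfolding frechet_derivative_barrier by (rule fun_cong)
qed

text \<open>This is the chain rule \<psi>'' |\<nabla>q|^2 + \<psi>' \<Delta>q, where |\<nabla>q|^2 =
  q^6 |x|^2 and \<Delta>q = 3 q^5 |x|^2 - n q^3.\<close>

lemma laplacian_barrier:
  fixes x :: "'b::euclidean_space"
  defines "q \<equiv> inv_dist \<epsilon> x"
  shows "laplacian (barrier \<epsilon> \<kappa>) x = flat_deriv2 (q - \<kappa>) * q ^ 6 * (x \<bullet> x)
      + flat_deriv (q - \<kappa>) * (3 * q ^ 5 * (x \<bullet> x) - q ^ 3 * DIM('b))"
proof -
  have "x \<bullet> x = (\<Sum>b\<in>Basis. (x \<bullet> b) * (x \<bullet> b))" by (rule euclidean_inner)
  moreover have "real DIM('b) = (\<Sum>b\<in>Basis. (b::'b) \<bullet> b)" by (simp add: inner_same_Basis)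
  ultimately show ?thesis
    unfolding laplacian_def second_derivative_barrier q_def[symmetric]
    by (simp add: sum.distrib sum_subtractf sum_distrib_left algebra_simps)
qed

lemma inv_dist_less: "inv_dist \<epsilon> (x::'b::euclidean_space) < \<kappa>" if "1 / \<kappa> \<le> norm x"
proof -
  let ?q = "inv_dist \<epsilon> x"
  have "1 = ?q\<^sup>2 * (\<epsilon>\<^sup>2 + (norm x)\<^sup>2)" using inv_dist_square[of x] by (simp add: dot_square_norm)
  also have "\<dots> > ?q\<^sup>2 * (norm x)\<^sup>2"
    using \<epsilon> inv_dist_pos[of x] by (intro mult_strict_left_mono) auto
  finally have "(?q * norm x)\<^sup>2 < 1\<^sup>2" by (simp add: power_mult_distrib)
  then have "?q * norm x < 1" by (rule power2_less_imp_less) simp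
  moreover have "?q * (1 / \<kappa>) \<le> ?q * norm x"
    using inv_dist_pos[of x] that by (intro mult_left_mono) auto
  ultimately have "?q * (1 / \<kappa>) < 1" by linarith
  then show ?thesis using \<kappa> by (simp add: field_simps)
qed

lemma test_function_barrier:
  assumes "1 / \<kappa> < R"
  shows "test_function (ball (0::'b::euclidean_space) R) (barrier \<epsilon> \<kappa>)"
proof -
  have "closure {x::'b. barrier \<epsilon> \<kappa> x \<noteq> 0} \<subseteq> cball 0 (1 / \<kappa>)"
  proof (rule closure_minimal)
    show "{x::'b. barrier \<epsilon> \<kappa> x \<noteq> 0} \<subseteq> cball 0 (1 / \<kappa>)"
    proof
      fix x :: 'b assume "x \<in> {x. barrier \<epsilon> \<kappa> x \<noteq> 0}"
      then have "\<not> inv_dist \<epsilon> x < \<kappa>" by (auto simp: barrier_def flat_powr_nonpos_arg)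
      then show "x \<in> cball 0 (1 / \<kappa>)" using inv_dist_less[of x] by force
    qed
  qed simp
  moreover have "Ck k (\<lambda>x::'b. flat_powr 1 (inv_dist \<epsilon> x + (- \<kappa>)))" for k
    unfolding inv_dist_def
    by (rule Ck_compose[OF Ck_flat_powr Ck_add[OF Ck_norm_square_powr[OF \<epsilon>] Ck_const]])
  ultimately show ?thesis
    unfolding test_function_def barrier_def[abs_def] using assms
    by (auto intro: bounded_subset[OF bounded_cball] simp: compact_eq_bounded_closed)
qed

text \<open>Since q^2 |x|^2 \<le> 1, the first-order term is at most \<psi>' q^3 (3 - n), which is
  nonpositive in dimension at least 3. The term with \<psi>'' is nonpositive once
  \<open>q > \<kappa> + 2\<close>; otherwise q^6 |x|^2 \<le> q^4 is bounded by
  \<open>(2 + \<kappa>) ^ 4\<close>. Nothing here depends on \<epsilon>.\<close>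

lemma laplacian_barrier_le:
  fixes x :: "'b::euclidean_space"
  assumes n: "DIM('b) \<ge> 3" and B: "B \<ge> 0" "\<And>s. flat_deriv2 s \<le> B" "\<And>s. s > 2 \<Longrightarrow> flat_deriv2 s \<le> 0"
  shows "laplacian (barrier \<epsilon> \<kappa>) x \<le> B * (2 + \<kappa>) ^ 4 * indicator (ball 0 (1 / \<kappa>)) x"
proof -
  define q where "q = inv_dist \<epsilon> x"
  have q: "q > 0" "q\<^sup>2 * (x \<bullet> x) \<le> 1" unfolding q_def by (rule inv_dist_pos inv_dist_square_norm)+
  show ?thesis
  proof (cases "norm x < 1 / \<kappa>")
    case False
    then have "q - \<kappa> \<le> 0" using inv_dist_less[of x] by (simp add: q_def)
    then show ?thesis using False
      by (simp add: laplacian_barrier flat_deriv_def flat_deriv2_def flat_powr_nonpos_arg flip: q_def)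
  next
    case True
    have "3 * q ^ 5 * (x \<bullet> x) = 3 * q ^ 3 * (q\<^sup>2 * (x \<bullet> x))" by (simp add: eval_nat_numeral)
    also have "\<dots> \<le> 3 * q ^ 3" using q by (intro mult_left_le) auto
    also have "\<dots> \<le> q ^ 3 * DIM('b)" using n q by simp
    finally have "flat_deriv (q - \<kappa>) * (3 * q ^ 5 * (x \<bullet> x) - q ^ 3 * DIM('b)) \<le> 0"
      using flat_deriv_bounds(1) by (intro mult_nonneg_nonpos) auto
    moreover have "flat_deriv2 (q - \<kappa>) * q ^ 6 * (x \<bullet> x) \<le> B * (2 + \<kappa>) ^ 4"
    proof (cases "q - \<kappa> > 2")
      case True
      then have "flat_deriv2 (q - \<kappa>) * (q ^ 6 * (x \<bullet> x)) \<le> 0" by (intro mult_nonpos_nonneg B(3)) auto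
      moreover have "0 \<le> B * (2 + \<kappa>) ^ 4" using B \<kappa> by simp
      ultimately show ?thesis by (simp add: mult.assoc)
    next
      case False
      have "q ^ 6 * (x \<bullet> x) = q ^ 4 * (q\<^sup>2 * (x \<bullet> x))" by (simp add: eval_nat_numeral)
      also have "\<dots> \<le> q ^ 4" using q by (intro mult_left_le) auto
      also have "\<dots> \<le> (2 + \<kappa>) ^ 4" using False q by (intro power_mono) auto
      finally have "flat_deriv2 (q - \<kappa>) * (q ^ 6 * (x \<bullet> x)) \<le> B * (2 + \<kappa>) ^ 4"
        using B by (intro mult_mono) auto
      then show ?thesis by (simp add: mult.assoc)
    qed
    ultimately show ?thesis using True by (simp add: laplacian_barrier flip: q_def)
  qed
qed

text \<open>The drift equals \<psi>' q^3 (g \<bullet> x), at most 2 c q because q^2 |x|^2 \<le> 1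
  and \<psi>' \<le> 2. Linear growth of \<psi> then bounds q by a multiple of the weight. The bound
  on \<open>g\<close> is asked for only where the barrier can vary.\<close>

lemma drift_barrier_le:
  fixes x g :: "'b::euclidean_space"
  assumes g: "norm x < 1 / \<kappa> \<Longrightarrow> g \<bullet> x \<le> c * (x \<bullet> x)" and c: "c \<ge> 0"
  shows "- (g \<bullet> grad (barrier \<epsilon> \<kappa>) x) \<le> 2 * c * (\<kappa> + 1 + exp 1) * (1 + barrier \<epsilon> \<kappa> x)"
proof -
  define q where "q = inv_dist \<epsilon> x"
  have q: "q > 0" "q\<^sup>2 * (x \<bullet> x) \<le> 1" unfolding q_def by (rule inv_dist_pos inv_dist_square_norm)+
  have eq: "- (g \<bullet> grad (barrier \<epsilon> \<kappa>) x) = flat_deriv (q - \<kappa>) * q ^ 3 * (g \<bullet> x)"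
    by (simp add: grad_barrier flip: q_def)
  show ?thesis
  proof (cases "norm x < 1 / \<kappa>")
    case False
    then have "q - \<kappa> \<le> 0" using inv_dist_less[of x] by (simp add: q_def)
    then show ?thesis using eq barrier_nonneg[of x] c \<kappa>
      by (simp add: flat_deriv_def flat_powr_nonpos_arg add_nonneg_nonneg)
  next
    case True
    have "flat_deriv (q - \<kappa>) * q ^ 3 * (g \<bullet> x) \<le> flat_deriv (q - \<kappa>) * q ^ 3 * (c * (x \<bullet> x))"
      using g[OF True] flat_deriv_bounds(1) q by (intro mult_left_mono) auto
    also have "\<dots> = flat_deriv (q - \<kappa>) * (c * q * (q\<^sup>2 * (x \<bullet> x)))" by (simp add: eval_nat_numeral)
    also have "\<dots> \<le> flat_deriv (q - \<kappa>) * (c * q)"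
      using q c flat_deriv_bounds(1) by (intro mult_left_mono mult_left_le) auto
    also have "\<dots> \<le> 2 * (c * q)" using q c flat_deriv_bounds(2) by (intro mult_right_mono) auto
    also have "\<dots> \<le> 2 * (c * (\<kappa> + 1 + exp 1 * barrier \<epsilon> \<kappa> x))"
      using le_flat_powr_1[of "q - \<kappa>"] c by (intro mult_left_mono) (auto simp: barrier_def q_def)
    also have "\<dots> \<le> 2 * (c * ((\<kappa> + 1 + exp 1) * (1 + barrier \<epsilon> \<kappa> x)))"
    proof -
      have "0 \<le> exp 1 + (\<kappa> + 1) * barrier \<epsilon> \<kappa> x" using \<kappa> barrier_nonneg[of x] by (simp add: add_nonneg_nonneg)
      then show ?thesis using c by (intro mult_left_mono) (auto simp: algebra_simps)
    qed
    finally show ?thesis using eq by (simp add: mult.assoc)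
  qed
qed

text \<open>For \<open>norm x \<le> \<epsilon>\<close> one has
  \<open>2 * \<epsilon> * q \<ge> 1\<close>; the smallness condition on \<epsilon> ensures that
  subtracting \<kappa> costs at most half of \<open>4 * \<epsilon> * q\<close>.\<close>

lemma barrier_lower:
  fixes x :: "'b::euclidean_space"
  assumes "norm x \<le> \<epsilon>" "4 * \<kappa> * \<epsilon> \<le> 1"
  shows "1 \<le> 4 * exp 1 * \<epsilon> * (1 + barrier \<epsilon> \<kappa> x)"
proof -
  define q where "q = inv_dist \<epsilon> x"
  have q: "q > 0" unfolding q_def by (rule inv_dist_pos)
  have "x \<bullet> x \<le> \<epsilon>\<^sup>2" using assms(1) \<epsilon> by (simp add: dot_square_norm power_mono)
  \<comment> \<open>The factor 4 instead of 2 makes the bound a perfect square.\<close>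
  then have "\<epsilon>\<^sup>2 + x \<bullet> x \<le> 4 * \<epsilon>\<^sup>2" using zero_le_power2[of \<epsilon>] by linarith
  then have "q\<^sup>2 * (\<epsilon>\<^sup>2 + x \<bullet> x) \<le> q\<^sup>2 * (4 * \<epsilon>\<^sup>2)" by (rule mult_left_mono) simp
  then have "1\<^sup>2 \<le> (2 * \<epsilon> * q)\<^sup>2" by (simp add: inv_dist_square q_def power_mult_distrib mult.commute)
  then have "1 \<le> 2 * \<epsilon> * q" by (rule power2_le_imp_le) (use q \<epsilon> in auto)
  then have "1 \<le> 4 * \<epsilon> * (q - \<kappa>)" using assms(2) by (simp add: algebra_simps)
  also have "\<dots> \<le> 4 * \<epsilon> * (1 + exp 1 * barrier \<epsilon> \<kappa> x)"
    using le_flat_powr_1[of "q - \<kappa>"] \<epsilon> by (intro mult_left_mono) (auto simp: barrier_def q_def)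
  also have "\<dots> \<le> 4 * \<epsilon> * (exp 1 * (1 + barrier \<epsilon> \<kappa> x))"
    using \<epsilon> by (intro mult_left_mono) (auto simp: algebra_simps)
  finally show ?thesis by (simp add: ac_simps)
qed

lemma barrier_le_inv_dist: "barrier \<epsilon> \<kappa> x \<le> inv_dist \<epsilon> x"
proof (cases "inv_dist \<epsilon> x - \<kappa> \<ge> 0")
  case True
  then show ?thesis using flat_powr_1_le[OF True] \<kappa> by (simp add: barrier_def)
next
  case False
  then show ?thesis using inv_dist_pos[of x] by (simp add: barrier_def flat_powr_nonpos_arg)
qed

end

section \<open>The potential near the origin\<close>

lemma grad_inner_differentiable:
  assumes "f differentiable (at x)"
  shows "grad f x \<bullet> h = frechet_derivative f (at x) h"
proof -
  have lin: "linear (frechet_derivative f (at x))"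
    using assms by (intro has_derivative_linear) (auto simp: frechet_derivative_works)
  have "frechet_derivative f (at x) h = frechet_derivative f (at x) (\<Sum>b\<in>Basis. (h \<bullet> b) *\<^sub>R b)"
    by (simp add: euclidean_representation)
  also have "\<dots> = (\<Sum>b\<in>Basis. (h \<bullet> b) * frechet_derivative f (at x) b)"
    using lin by (simp add: linear_sum linear_cmul)
  also have "\<dots> = grad f x \<bullet> h"
    unfolding grad_def inner_sum_left by (intro sum.cong) (simp_all add: inner_commute[of h])
  finally show ?thesis by simp
qed

lemma has_real_derivative_along_ray:
  assumes "\<And>x. f differentiable (at x)"
  shows "((\<lambda>s. f (s *\<^sub>R e)) has_real_derivative grad f (s *\<^sub>R e) \<bullet> e) (at s)"
proof -
  have "((\<lambda>s. f (s *\<^sub>R e)) has_derivative (\<lambda>h. frechet_derivative f (at (s *\<^sub>R e)) (h *\<^sub>R e))) (at s)"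
    by (rule has_derivative_compose[OF _ frechet_derivative_works[THEN iffD1, OF assms]])
      (auto intro!: derivative_eq_intros)
  moreover have "(\<lambda>h. frechet_derivative f (at (s *\<^sub>R e)) (h *\<^sub>R e)) = (*) (grad f (s *\<^sub>R e) \<bullet> e)"
    by (rule ext) (simp add: mult.commute flip: grad_inner_differentiable[OF assms])
  ultimately show ?thesis by (simp add: has_field_derivative_def)
qed

context
  fixes V :: "'a::euclidean_space \<Rightarrow> real" and C_V R_V :: real
  assumes V_diff: "\<And>x. V differentiable (at x)"
    and V_deriv: "\<forall>e r. norm e = 1 \<and> 0 < r \<and> r < R_V \<longrightarrow> deriv (\<lambda>s. V (s *\<^sub>R e)) r \<le> C_V * r"
    and C_V: "C_V > 0"
begin

lemma grad_inner_le:
  assumes "norm x < R_V" shows "grad V x \<bullet> x \<le> C_V * (x \<bullet> x)"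
proof (cases "x = 0")
  case False
  define e where "e = x /\<^sub>R norm x"
  have x: "norm x *\<^sub>R e = x" and e: "norm e = 1" using False by (simp_all add: e_def)
  have "deriv (\<lambda>s. V (s *\<^sub>R e)) (norm x) = grad V x \<bullet> e"
    using DERIV_imp_deriv[OF has_real_derivative_along_ray[of V e "norm x", OF V_diff]] x by simp
  moreover have "deriv (\<lambda>s. V (s *\<^sub>R e)) (norm x) \<le> C_V * norm x"
    using V_deriv e False assms by simp
  ultimately have "norm x * (grad V x \<bullet> e) \<le> norm x * (C_V * norm x)"
    by (intro mult_left_mono) auto
  moreover have "norm x * (grad V x \<bullet> e) = grad V x \<bullet> x"
    using x by (metis inner_scaleR_right)
  ultimately show ?thesis by (simp add: dot_square_norm power2_eq_square ac_simps)
qed simp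

text \<open>The mean value theorem along the ray is enough; integrating the bound would give the
  constant \<open>C_V / 2\<close>, but only the quadratic order matters.\<close>

lemma potential_le:
  assumes "norm x < R_V" "V 0 = 0" shows "V x \<le> C_V * (norm x)\<^sup>2"
proof (cases "x = 0")
  case False
  define e where "e = x /\<^sub>R norm x"
  have x: "norm x *\<^sub>R e = x" and e: "norm e = 1" using False by (simp_all add: e_def)
  obtain z where z: "0 < z" "z < norm x"
    "V (norm x *\<^sub>R e) - V (0 *\<^sub>R e) = (norm x - 0) * (grad V (z *\<^sub>R e) \<bullet> e)"
    using MVT2[of 0 "norm x" "\<lambda>s. V (s *\<^sub>R e)", OF _ has_real_derivative_along_ray[OF V_diff]] False
    by auto
  have "deriv (\<lambda>s. V (s *\<^sub>R e)) z = grad V (z *\<^sub>R e) \<bullet> e"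
    using DERIV_imp_deriv[OF has_real_derivative_along_ray[of V e z, OF V_diff]] by simp
  moreover have "deriv (\<lambda>s. V (s *\<^sub>R e)) z \<le> C_V * z"
    using V_deriv e z assms by simp
  moreover have "C_V * z \<le> C_V * norm x" using z C_V by simp
  ultimately have "norm x * (grad V (z *\<^sub>R e) \<bullet> e) \<le> norm x * (C_V * norm x)"
    by (intro mult_left_mono) auto
  then show ?thesis using z(3) x assms(2) by (simp add: power2_eq_square ac_simps)
qed (use assms in simp)

text \<open>Quadratic growth of \<open>V\<close> makes the integrand at least a constant times
  |x|^(-2p) with p \<ge> 1. In dimension at most 2 its integral over the ball of radius
  \<open>r\<close> then stays above a positive constant independent of \<open>r\<close>, which
  contradicts integrability as \<open>r\<close> tends to 0.\<close>

lemma DIM_ge_3: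
  assumes m: "0 < m" "m < 1" and incr: "radially_strictly_increasing_on UNIV V" and V0: "V 0 = 0"
    and \<epsilon>0: "\<epsilon>0 > 0" and R_V: "R_V > 0"
    and int: "integrable (lebesgue_on (ball 0 1)) (\<lambda>x. rho_V m V x powr (1 + \<epsilon>0))"
  shows "DIM('a) \<ge> 3"
proof (rule ccontr)
  assume "\<not> DIM('a) \<ge> 3"
  then have n: "DIM('a) \<le> 2" by simp
  let ?B = "ball (0::'a) 1"
  define f where "f x = rho_V m V x powr (1 + \<epsilon>0)" for x
  define a where "a = (1 - m) / m * C_V"
  define p where "p = (1 + \<epsilon>0) / (1 - m)"
  have a: "a > 0" and p: "p \<ge> 1" using m C_V \<epsilon>0 by (auto simp: a_def p_def field_simps)
  have lower: "a powr (- p) * r powr (- real DIM('a)) \<le> f x"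
    if "x \<noteq> 0" "norm x < r" "r \<le> 1" "r \<le> R_V" for x r
  proof -
    \<comment> \<open>Positivity excludes the default value of \<open>powr\<close> at 0 and makes a
      negative power antitone.\<close>
    have "V x > 0" using incr V0 that(1) unfolding radially_strictly_increasing_on_def
      by (metis UNIV_I norm_zero zero_less_norm_iff)
    then have y: "0 < (1 - m) / m * V x" using m by simp
    have "V x \<le> C_V * (norm x)\<^sup>2" using potential_le[of x] that V0 by simp
    also have "\<dots> \<le> C_V * r\<^sup>2" using that C_V by (intro mult_left_mono power_mono) auto
    finally have "(1 - m) / m * V x \<le> (1 - m) / m * (C_V * r\<^sup>2)" using m by (intro mult_left_mono) auto
    then have le: "(1 - m) / m * V x \<le> a * r\<^sup>2" by (simp add: a_def ac_simps)
    have r: "r > 0" using that norm_ge_zero[of x] by linarith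
    \<comment> \<open>The dimension is at most 2, hence at most \<open>2 * p\<close>, and
      \<open>r \<le> 1\<close>.\<close>
    have "r powr (- real DIM('a)) \<le> r powr (- 2 * p)"
      using r that n p by (intro powr_mono') auto
    then have "a powr (- p) * r powr (- real DIM('a)) \<le> a powr (- p) * r powr (- 2 * p)"
      by (intro mult_left_mono) auto
    also have "\<dots> = (a * r\<^sup>2) powr (- p)"
      using r a by (simp add: powr_mult powr_powr flip: powr_numeral)
    also have "\<dots> \<le> ((1 - m) / m * V x) powr (- p)"
      using y le p by (intro powr_mono2') auto
    also have "\<dots> = f x" by (simp add: f_def rho_V_def powr_powr p_def field_simps)
    finally show ?thesis .
  qed
  \<comment> \<open>The factor \<open>min 1 R_V\<close> keeps the balls inside the unit ball and
    inside the region where the bound on \<open>V\<close> holds.\<close>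
  define r where "r k = min 1 R_V * inverse (real (Suc k))" for k
  have r: "0 < r k" "r k \<le> 1" "r k \<le> R_V" for k
  proof -
    have "inverse (real (Suc k)) \<le> 1" by (simp add: inverse_le_1_iff)
    then have "r k \<le> min 1 R_V * 1" unfolding r_def using R_V by (intro mult_left_mono) auto
    then show "0 < r k" "r k \<le> 1" "r k \<le> R_V" using R_V by (auto simp: r_def)
  qed
  have rlim: "r \<longlonglongrightarrow> 0"
    using tendsto_mult_right_zero[OF LIMSEQ_inverse_real_of_nat, of "min 1 R_V"] by (simp add: r_def[abs_def])
  have fi: "integrable (lebesgue_on ?B) f" using int by (simp add: f_def[abs_def])
  have ne0: "AE x in lebesgue_on ?B. x \<noteq> 0"
    by (subst AE_restrict_space_iff) (auto intro: AE_mp[OF AE_not_in[of "{0}"]])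
  have "(\<lambda>k. LINT x|lebesgue_on ?B. indicator (ball 0 (r k)) x * f x) \<longlonglongrightarrow> (LINT x|lebesgue_on ?B. 0)"
  proof (rule integral_dominated_convergence)
    show "AE x in lebesgue_on ?B. (\<lambda>k. indicator (ball 0 (r k)) x * f x) \<longlonglongrightarrow> 0"
      using ne0
    proof eventually_elim
      case (elim x)
      have "\<forall>\<^sub>F k in sequentially. r k < norm x"
        using order_tendstoD(2)[OF rlim, of "norm x"] elim by simp
      then show ?case by (intro tendsto_eventually) (auto elim!: eventually_mono)
    qed
    show "integrable (lebesgue_on ?B) (\<lambda>x. \<bar>f x\<bar>)" using fi by simp
    show "(\<lambda>x. indicator (ball 0 (r k)) x * f x) \<in> borel_measurable (lebesgue_on ?B)" for k
      using borel_measurable_integrable[OF fi] by (intro borel_measurable_times borel_measurable_indicator')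
        (auto simp: sets_restrict_space_iff)
  qed (auto simp: indicator_def)
  moreover have "a powr (- p) * unit_ball_vol DIM('a) \<le> (LINT x|lebesgue_on ?B. indicator (ball 0 (r k)) x * f x)" for k
  proof -
    let ?c = "a powr (- p) * r k powr (- real DIM('a))"
    have sub: "ball 0 (r k) \<subseteq> ?B" using r[of k] by auto
    have iI: "integrable (lebesgue_on ?B) (\<lambda>x. indicator (ball 0 (r k)) x * f x)"
      using integrable_mult_indicator[of "ball 0 (r k)" "lebesgue_on ?B" f] fi sub
      by (auto simp: sets_restrict_space_iff)
    have "a powr (- p) * unit_ball_vol DIM('a) = ?c * measure lebesgue (ball (0::'a) (r k))"
      using r(1)[of k] by (simp add: content_ball powr_minus powr_realpow)
    also have "\<dots> = (LINT x|lebesgue_on ?B. indicator (ball 0 (r k)) x * ?c)"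
      using sub by (simp add: measure_restrict_space sets_restrict_space_iff Int_absorb2)
    also have "\<dots> \<le> (LINT x|lebesgue_on ?B. indicator (ball 0 (r k)) x * f x)"
    proof (rule integral_mono_AE'[OF iI])
      show "AE x in lebesgue_on ?B. indicator (ball 0 (r k)) x * ?c \<le> indicator (ball 0 (r k)) x * f x"
        using ne0 by eventually_elim (use lower r in \<open>auto simp: indicator_def\<close>)
      show "AE x in lebesgue_on ?B. 0 \<le> indicator (ball 0 (r k)) x * f x" by (simp add: f_def)
    qed
    finally show ?thesis .
  qed
  ultimately have "a powr (- p) * unit_ball_vol DIM('a) \<le> 0"
    by (intro LIMSEQ_le_const) auto
  moreover have "a powr (- p) * unit_ball_vol DIM('a) > 0" using a by simp
  ultimately show False by simp
qed

end

section \<open>Absence of concentration\<close>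

lemma unit_vol_pos: "unit_vol TYPE('a::euclidean_space) > 0"
  by (simp add: unit_vol_def content_ball)

lemma vol_ball_subset:
  assumes "0 \<le> v" "v \<le> unit_vol TYPE('a) * r ^ DIM('a)" "0 \<le> r"
  shows "(vol_ball v :: 'a::euclidean_space set) \<subseteq> ball 0 r"
proof -
  have "v / unit_vol TYPE('a) \<le> r ^ DIM('a)"
    using assms(2) unit_vol_pos[where 'a = 'a] by (simp add: field_simps)
  then have "root DIM('a) (v / unit_vol TYPE('a)) \<le> root DIM('a) (r ^ DIM('a))"
    by (intro real_root_le_mono) auto
  also have "\<dots> = r" using assms(3) by (intro real_root_power_cancel) auto
  finally show ?thesis unfolding vol_ball_def by (rule subset_ball)
qed

text \<open>A weight that is at least 1 on the ball of radius \<open>r\<close> dominates its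
  indicator. The volume restriction puts \<open>vol_ball v\<close> inside that ball and selects the
  integral branch of \<open>ball_mass\<close>.\<close>

lemma ball_mass_le:
  fixes \<Phi> \<rho>0 :: "'a::euclidean_space \<Rightarrow> real"
  assumes v: "0 \<le> v" "v \<le> unit_vol TYPE('a) * r ^ DIM('a)" and r: "0 \<le> r" "r \<le> R"
    and \<rho>: "nonneg_L1 R (S t \<rho>0)" and \<Phi>: "integrable (lebesgue_on (ball 0 R)) (\<lambda>x. S t \<rho>0 x * \<Phi> x)"
    and \<Phi>1: "\<And>x. 0 \<le> \<Phi> x" "\<And>x. x \<in> ball 0 r \<Longrightarrow> 1 \<le> \<Phi> x"
  shows "0 \<le> ball_mass R S \<rho>0 t v" "ball_mass R S \<rho>0 t v \<le> (LINT x|lebesgue_on (ball 0 R). S t \<rho>0 x * \<Phi> x)"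
proof -
  have "v \<le> unit_vol TYPE('a) * R ^ DIM('a)"
    using v(2) mult_left_mono[OF power_mono[OF r(2,1)] less_imp_le[OF unit_vol_pos[where 'a = 'a]]]
    by (rule order_trans)
  then have eq: "ball_mass R S \<rho>0 t v = (LINT x|lebesgue_on (vol_ball v). S t \<rho>0 x)"
    by (simp add: ball_mass_def)
  have sub: "(vol_ball v :: 'a set) \<subseteq> ball 0 r" by (rule vol_ball_subset[OF v r(1)])
  then have sub': "(vol_ball v :: 'a set) \<subseteq> ball 0 R" using r(2) by auto
  have meas: "(vol_ball v :: 'a set) \<in> sets lebesgue" by (simp add: vol_ball_def)
  have pos: "AE x in lebesgue_on (ball 0 R). 0 \<le> S t \<rho>0 x" using \<rho> by (simp add: nonneg_L1_def)
  then have pos': "AE x in lebesgue_on (vol_ball v). 0 \<le> S t \<rho>0 x"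
    using sub' meas by (auto simp: AE_restrict_space_iff elim!: eventually_mono)
  show "0 \<le> ball_mass R S \<rho>0 t v" unfolding eq by (rule integral_nonneg_AE[OF pos'])
  show "ball_mass R S \<rho>0 t v \<le> (LINT x|lebesgue_on (ball 0 R). S t \<rho>0 x * \<Phi> x)"
    unfolding eq
  proof (rule integral_mono_lebesgue_on_AE[OF \<Phi> _ _ sub' meas])
    show "AE x in lebesgue_on (vol_ball v). S t \<rho>0 x \<le> S t \<rho>0 x * \<Phi> x"
      using pos' AE_space
    proof eventually_elim
      case (elim x)
      then have "x \<in> ball 0 r" using sub by auto
      then show ?case using mult_left_mono[OF \<Phi>1(2) elim(1)] by simp
    qed
    show "AE x in lebesgue_on (ball 0 R). 0 \<le> S t \<rho>0 x * \<Phi> x"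
      using pos by eventually_elim (simp add: \<Phi>1(1))
  qed auto
qed

lemma grad_ball_potential:
  fixes V W :: "'a::euclidean_space \<Rightarrow> real"
  assumes "ball_potential V R W" "V differentiable (at x)" "norm x < R - 1"
  shows "grad W x = grad V x"
proof -
  have "frechet_derivative V (at x) = frechet_derivative W (at x)"
    by (rule frechet_derivative_transform_within_open[of _ _ "ball 0 (R - 1)"])
      (use assms in \<open>auto simp: ball_potential_def\<close>)
  then show ?thesis by (simp add: grad_def)
qed

theorem theorem1p4:
  fixes m \<epsilon>0 C_V R_V :: real
    and V \<rho>0 :: "'a::euclidean_space \<Rightarrow> real"
    and M :: "real \<Rightarrow> real \<Rightarrow> real"
  assumes m: "0 < m" "m < 1"
    and V_reg: "W2inf_loc V"
    and V_radial: "radial_on UNIV V"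
    and V_incr: "radially_strictly_increasing_on UNIV V"
    and V_nonneg: "\<forall>x. V x \<ge> 0"
    and V_zero: "V 0 = 0"
    and \<epsilon>0: "\<epsilon>0 > 0"
    and rho_V_int: "integrable (lebesgue_on (ball 0 1)) (\<lambda>x. rho_V m V x powr (1 + \<epsilon>0))"
    and pos: "C_V > 0" "R_V > 0"
    and V_deriv: "\<forall>e r. norm e = 1 \<and> 0 < r \<and> r < R_V \<longrightarrow> deriv (\<lambda>s. V (s *\<^sub>R e)) r \<le> C_V * r"
    and rho0_nonneg: "\<forall>x. \<rho>0 x \<ge> 0"
    and rho0_int: "integrable lebesgue \<rho>0"
    and rho0_radial: "radial_on UNIV \<rho>0"
    and rho0_decr: "radially_nonincreasing \<rho>0"
    and rho0_mass: "(LINT x|lebesgue. \<bar>\<rho>0 x\<bar>) = 1"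
    and M: "viscosity_mass_solution m V \<rho>0 M"
    and M_init: "\<forall>v>0. M 0 v = (LINT x|lebesgue_on (vol_ball v). \<rho>0 x)"
  shows "\<forall>t>0. (M t \<longlongrightarrow> 0) (at_right 0)"
proof (intro allI impI)
  fix t :: real assume t: "t > 0"
  have V_diff: "V differentiable (at x)" for x
  proof -
    have "W2inf (ball 0 (norm x + 1)) V" using V_reg by (simp add: W2inf_loc_def add_nonneg_pos)
    then show ?thesis unfolding W2inf_def C1_on_def by simp
  qed
  have n: "DIM('a) \<ge> 3"
    by (rule DIM_ge_3[OF V_diff V_deriv pos(1) m V_incr V_zero \<epsilon>0 pos(2) rho_V_int])
  obtain B where B: "B \<ge> 0" "\<And>s. flat_deriv2 s \<le> B" "\<And>s. s > 2 \<Longrightarrow> flat_deriv2 s \<le> 0"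
    by (rule flat_deriv2_bound) (rule that; simp)
  \<comment> \<open>This places the support of the barrier in the closed ball of radius
    \<open>R_V\<close>, the region governed by the bound on the radial derivative of
    \<open>V\<close>.\<close>
  define \<kappa> where "\<kappa> = 1 / R_V"
  have \<kappa>: "\<kappa> > 0" "1 / \<kappa> = R_V" using pos by (simp_all add: \<kappa>_def)
  define A where "A = 2 * C_V * (\<kappa> + 1 + exp 1)"
  define C where "C = B * (2 + \<kappa>) ^ 4"
  have A: "A > 0" unfolding A_def using pos \<kappa> by (intro mult_pos_pos add_pos_pos) auto
  have C: "C \<ge> 0" "C + A > 0" using B \<kappa> A by (auto simp: C_def add_nonneg_pos)
  define N where "N = C * measure lebesgue (ball 0 R_V :: 'a set) / (C + A)"
  \<comment> \<open>The normalisation of \<open>barrier_lower\<close>: \<Phi> is at least 1 on the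
    ball of radius \<epsilon>, yet bounded uniformly for bounded \<epsilon>.\<close>
  define \<Phi> where "\<Phi> \<epsilon> x = 4 * exp 1 * \<epsilon> * (1 + barrier \<epsilon> \<kappa> x)" for \<epsilon> and x :: 'a
  define bound where "bound \<epsilon> = ((LINT x|lebesgue. \<rho>0 x * \<Phi> \<epsilon> x) + 4 * exp 1 * \<epsilon> * N) * exp ((C + A) * t)" for \<epsilon>
  have \<Phi>0: "0 \<le> \<Phi> \<epsilon> x" if "\<epsilon> > 0" for \<epsilon> x
    using that barrier_nonneg[OF that \<kappa>(1), of x] by (simp add: \<Phi>_def)
  have \<Phi>_le: "\<Phi> \<epsilon> x \<le> 4 * exp 1 * (\<epsilon> + 1)" if "\<epsilon> > 0" for \<epsilon> x
  proof -
    have "\<epsilon> * barrier \<epsilon> \<kappa> x \<le> \<epsilon> * inv_dist \<epsilon> x"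
      using that barrier_le_inv_dist[OF that \<kappa>(1), of x] by (intro mult_left_mono) auto
    also have "\<dots> \<le> 1" by (rule inv_dist_le[OF that \<kappa>(1)])
    finally have "4 * exp 1 * (\<epsilon> + \<epsilon> * barrier \<epsilon> \<kappa> x) \<le> 4 * exp 1 * (\<epsilon> + 1)" by simp
    then show ?thesis by (simp add: \<Phi>_def algebra_simps)
  qed
  have \<Phi>_cont: "continuous_on UNIV (\<Phi> \<epsilon>)" if "\<epsilon> > 0" for \<epsilon>
  proof -
    have "test_function (ball (0::'a) (R_V + 1)) (barrier \<epsilon> \<kappa>)"
      by (rule test_function_barrier[OF that \<kappa>(1)]) (simp add: \<kappa>(2))
    then have "continuous_on UNIV (barrier \<epsilon> \<kappa> :: 'a \<Rightarrow> real)"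
      using Ck_test_function[of _ _ 0] by fastforce
    then show ?thesis unfolding \<Phi>_def[abs_def] by (intro continuous_intros)
  qed
  have \<Phi>_meas: "\<Phi> \<epsilon> \<in> borel_measurable lebesgue" if "\<epsilon> > 0" for \<epsilon>
    using borel_measurable_continuous_onI[OF \<Phi>_cont[OF that]] by (intro measurable_completion) simp
  have \<Phi>_abs: "\<bar>\<Phi> \<epsilon> x\<bar> \<le> 4 * exp 1 * (\<epsilon> + 1)" if "\<epsilon> > 0" for \<epsilon> x
    using \<Phi>0[OF that] \<Phi>_le[OF that] by simp
  obtain W S Rk where WS: "\<forall>R>1. ball_potential V R (W R) \<and> solution_operator m R (W R) (S R)"
    and Rk: "\<forall>k::nat. Rk k > 1" "filterlim Rk at_top sequentially"
    and lim: "\<forall>K. compact K \<and> K \<subseteq> {0..} \<times> {0<..} \<longrightarrow>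
      uniform_limit K (\<lambda>k (t, v). ball_mass (Rk k) (S (Rk k)) \<rho>0 t v) (\<lambda>(t, v). M t v) sequentially"
    using M unfolding viscosity_mass_solution_def by (elim exE conjE) (rule that; assumption)
  have W: "ball_potential V R (W R)" and S: "solution_operator m R (W R) (S R)" if "R > 1" for R
    using WS that by simp_all
  \<comment> \<open>An estimate uniform in \<open>R\<close>. The condition
    \<open>R > R_V + 1\<close> makes \<open>W R\<close> coincide with \<open>V\<close> around the
    support of the barrier.\<close>
  have mass: "0 \<le> ball_mass R (S R) \<rho>0 t v \<and> ball_mass R (S R) \<rho>0 t v \<le> bound \<epsilon>"
    if R: "R > 1" "R > R_V + 1" "\<epsilon> \<le> R" and \<epsilon>: "\<epsilon> > 0" "4 * \<kappa> * \<epsilon> \<le> 1"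
      and v: "0 < v" "v \<le> unit_vol TYPE('a) * \<epsilon> ^ DIM('a)" for R \<epsilon> v
  proof -
    let ?M = "lebesgue_on (ball (0::'a) R)"
    have W_C1: "C1_on (ball 0 R) (W R)" using W[OF R(1)] by (simp add: ball_potential_def W2inf_def)
    have \<rho>0: "nonneg_L1 R \<rho>0"
      unfolding nonneg_L1_def using rho0_int rho0_nonneg integrable_lebesgue_on_mono[of UNIV \<rho>0 "ball 0 R"]
      by (simp add: lebesgue_on_UNIV_eq)
    have S\<rho>: "nonneg_L1 R (S R t \<rho>0)"
      using S[OF R(1)] \<rho>0 t unfolding solution_operator_def by simp
    have drift: "- (grad (W R) x \<bullet> grad (barrier \<epsilon> \<kappa>) x) \<le> A * (1 + barrier \<epsilon> \<kappa> x)" for x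
      unfolding A_def
    proof (rule drift_barrier_le[OF \<epsilon>(1) \<kappa>(1)])
      assume "norm x < 1 / \<kappa>"
      then show "grad (W R) x \<bullet> x \<le> C_V * (x \<bullet> x)"
        using grad_inner_le[OF V_diff V_deriv pos(1), of x] grad_ball_potential[OF W[OF R(1)] V_diff, of x]
          R(2) \<kappa>(2) by simp
    qed (use pos in simp)
    have S_le: "(LINT x|?M. S R t \<rho>0 x * (1 + barrier \<epsilon> \<kappa> x))
        \<le> ((LINT x|?M. \<rho>0 x * (1 + barrier \<epsilon> \<kappa> x)) + C * measure lebesgue (ball 0 (1 / \<kappa>) :: 'a set) / (C + A)) * exp ((C + A) * t)"
      by (rule weighted_mass_bound[OF m W_C1 test_function_barrier[OF \<epsilon>(1) \<kappa>(1)] barrier_nonneg[OF \<epsilon>(1) \<kappa>(1)]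
            _ C drift S[OF R(1)] \<rho>0 t])
        (use R(2) \<kappa>(2) laplacian_barrier_le[OF \<epsilon>(1) \<kappa>(1) n B] in \<open>auto simp: C_def\<close>)
    have i: "integrable ?M (\<lambda>x. S R t \<rho>0 x * \<Phi> \<epsilon> x)"
      using S\<rho> by (intro integrable_mult_bounded[OF _ _ \<Phi>_abs[OF \<epsilon>(1)]]
          borel_measurable_integrable[OF integrable_lebesgue_on_ball] \<Phi>_cont[OF \<epsilon>(1)])
        (simp add: nonneg_L1_def)
    have low: "1 \<le> \<Phi> \<epsilon> x" if "x \<in> ball 0 \<epsilon>" for x
      using barrier_lower[OF \<epsilon>(1) \<kappa>(1), of x] that \<epsilon>(2) by (simp add: \<Phi>_def)
    have le: "0 \<le> ball_mass R (S R) \<rho>0 t v"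
      "ball_mass R (S R) \<rho>0 t v \<le> (LINT x|?M. S R t \<rho>0 x * \<Phi> \<epsilon> x)"
      using ball_mass_le[where S = "S R", OF _ v(2) _ R(3) S\<rho> i \<Phi>0[OF \<epsilon>(1)] low] v \<epsilon> by auto
    have scale: "(LINT x|?M. g x * \<Phi> \<epsilon> x) = 4 * exp 1 * \<epsilon> * (LINT x|?M. g x * (1 + barrier \<epsilon> \<kappa> x))" for g
    proof -
      have "(\<lambda>x. g x * \<Phi> \<epsilon> x) = (\<lambda>x. 4 * exp 1 * \<epsilon> * (g x * (1 + barrier \<epsilon> \<kappa> x)))"
        by (simp add: \<Phi>_def fun_eq_iff ac_simps)
      then show ?thesis by simp
    qed
    have "(LINT x|?M. S R t \<rho>0 x * \<Phi> \<epsilon> x)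
        \<le> 4 * exp 1 * \<epsilon> * (((LINT x|?M. \<rho>0 x * (1 + barrier \<epsilon> \<kappa> x)) + N) * exp ((C + A) * t))"
      unfolding scale using S_le \<epsilon>(1) by (intro mult_left_mono) (simp_all add: N_def \<kappa>(2))
    also have "\<dots> = ((LINT x|?M. \<rho>0 x * \<Phi> \<epsilon> x) + 4 * exp 1 * \<epsilon> * N) * exp ((C + A) * t)"
      unfolding scale by (simp add: algebra_simps)
    also have "\<dots> \<le> bound \<epsilon>"
    proof -
      \<comment> \<open>Enlarging the domain from the ball to the whole space removes the last
        dependence on \<open>R\<close>.\<close>
      have "integrable (lebesgue_on UNIV) (\<lambda>x. \<rho>0 x * \<Phi> \<epsilon> x)"
        unfolding lebesgue_on_UNIV_eq
        by (rule integrable_mult_bounded[OF rho0_int \<Phi>_meas[OF \<epsilon>(1)] \<Phi>_abs[OF \<epsilon>(1)]])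
      then have "(LINT x|?M. \<rho>0 x * \<Phi> \<epsilon> x) \<le> (LINT x|lebesgue_on UNIV. \<rho>0 x * \<Phi> \<epsilon> x)"
        by (rule integral_mono_lebesgue_on_AE) (use \<Phi>0[OF \<epsilon>(1)] rho0_nonneg in auto)
      then show ?thesis unfolding bound_def by (simp add: lebesgue_on_UNIV_eq)
    qed
    finally show ?thesis using le by simp
  qed
  define \<epsilon> where "\<epsilon> j = inverse (real (Suc j))" for j
  have \<epsilon>_pos: "\<epsilon> j > 0" and \<epsilon>_le: "\<epsilon> j \<le> 1" for j by (simp_all add: \<epsilon>_def inverse_le_1_iff)
  have \<epsilon>_lim: "\<epsilon> \<longlonglongrightarrow> 0" unfolding \<epsilon>_def[abs_def] by (rule LIMSEQ_inverse_real_of_nat)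
  have "(\<lambda>j. LINT x|lebesgue. \<rho>0 x * \<Phi> (\<epsilon> j) x) \<longlonglongrightarrow> (LINT x|(lebesgue::'a measure). (0::real))"
  proof (rule integral_dominated_convergence)
    \<comment> \<open>The factor 2 bounds \<open>\<epsilon> j + 1\<close>.\<close>
    show "integrable lebesgue (\<lambda>x. \<rho>0 x * (4 * exp 1 * 2))" using rho0_int by simp
    show "(\<lambda>x. \<rho>0 x * \<Phi> (\<epsilon> j) x) \<in> borel_measurable lebesgue" for j
      by (intro borel_measurable_times borel_measurable_integrable[OF rho0_int] \<Phi>_meas \<epsilon>_pos)
    show "AE x in lebesgue. norm (\<rho>0 x * \<Phi> (\<epsilon> j) x) \<le> \<rho>0 x * (4 * exp 1 * 2)" for j
    proof (rule AE_I2)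
      fix x
      have "4 * exp 1 * (\<epsilon> j + 1) \<le> 4 * exp 1 * (2::real)" using \<epsilon>_le[of j] by simp
      then have "\<bar>\<Phi> (\<epsilon> j) x\<bar> \<le> 4 * exp 1 * 2" using \<Phi>_abs[OF \<epsilon>_pos, of j x] by linarith
      then show "norm (\<rho>0 x * \<Phi> (\<epsilon> j) x) \<le> \<rho>0 x * (4 * exp 1 * 2)"
        using rho0_nonneg by (simp only: real_norm_def abs_mult abs_of_nonneg mult_left_mono)
    qed
    have "AE x in lebesgue. x \<noteq> (0::'a)" by (rule AE_mp[OF AE_not_in[of "{0}"]]) auto
    then show "AE x in lebesgue. (\<lambda>j. \<rho>0 x * \<Phi> (\<epsilon> j) x) \<longlonglongrightarrow> 0"
    proof eventually_elim
      case (elim x)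
      have "(\<lambda>j. \<Phi> (\<epsilon> j) x) \<longlonglongrightarrow> 0"
      proof (rule tendsto_sandwich[OF _ _ tendsto_const])
        show "\<forall>\<^sub>F j in sequentially. 0 \<le> \<Phi> (\<epsilon> j) x" by (simp add: \<Phi>0 \<epsilon>_pos)
        \<comment> \<open>Away from the origin the barrier is bounded independently of
          \<open>j\<close>, so the prefactor \<open>\<epsilon> j\<close> sends \<Phi> to 0 pointwise
          almost everywhere.\<close>
        have "barrier (\<epsilon> j) \<kappa> x \<le> 1 / norm x" for j
          using barrier_le_inv_dist[OF \<epsilon>_pos \<kappa>(1), of j x] inv_dist_le(1)[OF \<epsilon>_pos \<kappa>(1), of j x] elim
          by (simp add: field_simps) (metis mult_right_mono norm_ge_zero order_trans mult.commute)
        then show "\<forall>\<^sub>F j in sequentially. \<Phi> (\<epsilon> j) x \<le> 4 * exp 1 * \<epsilon> j * (1 + 1 / norm x)"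
          unfolding \<Phi>_def using \<epsilon>_pos by (intro always_eventually allI mult_left_mono) (auto simp: less_imp_le)
        show "(\<lambda>j. 4 * exp 1 * \<epsilon> j * (1 + 1 / norm x)) \<longlonglongrightarrow> 0"
          by (intro tendsto_mult_left_zero tendsto_mult_right_zero \<epsilon>_lim)
      qed
      then show ?case by (rule tendsto_mult_right_zero)
    qed
  qed simp
  then have bound_lim: "(\<lambda>j. bound (\<epsilon> j)) \<longlonglongrightarrow> 0"
    unfolding bound_def using \<epsilon>_lim
    by (intro tendsto_mult_left_zero tendsto_add_zero tendsto_mult_right_zero) simp_all
  have M_bound: "0 \<le> M t v \<and> M t v \<le> bound (\<epsilon> j)"
    if j: "4 * \<kappa> * \<epsilon> j \<le> 1" and v: "0 < v" "v \<le> unit_vol TYPE('a) * \<epsilon> j ^ DIM('a)" for v j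
  proof -
    \<comment> \<open>A singleton is a compact set, so locally uniform convergence yields the
      pointwise limit at \<open>(t, v)\<close>.\<close>
    have "uniform_limit {(t, v)} (\<lambda>k (t, v). ball_mass (Rk k) (S (Rk k)) \<rho>0 t v) (\<lambda>(t, v). M t v) sequentially"
      using t v by (intro lim[rule_format]) auto
    from tendsto_uniform_limitI[OF this, of "(t, v)"]
    have tends: "(\<lambda>k. ball_mass (Rk k) (S (Rk k)) \<rho>0 t v) \<longlonglongrightarrow> M t v" by simp
    have ev: "\<forall>\<^sub>F k in sequentially. 0 \<le> ball_mass (Rk k) (S (Rk k)) \<rho>0 t v \<and>
        ball_mass (Rk k) (S (Rk k)) \<rho>0 t v \<le> bound (\<epsilon> j)"
      using filterlim_at_top_dense[THEN iffD1, OF Rk(2), rule_format, of "R_V + 1"]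
    proof eventually_elim
      case (elim k)
      then show ?case
        using Rk(1)[rule_format, of k] \<epsilon>_le[of j] \<epsilon>_pos[of j] j v by (intro mass) auto
    qed
    show ?thesis
      using tendsto_lowerbound[OF tends] tendsto_upperbound[OF tends] ev
      by (auto simp: eventually_conj_iff)
  qed
  show "(M t \<longlongrightarrow> 0) (at_right 0)"
  proof (rule tendstoI)
    fix e :: real assume e: "e > 0"
    have "(\<lambda>j. 4 * \<kappa> * \<epsilon> j) \<longlonglongrightarrow> 0" by (intro tendsto_mult_right_zero \<epsilon>_lim)
    from order_tendstoD(2)[OF this, of 1] order_tendstoD(2)[OF bound_lim e]
    have "\<forall>\<^sub>F j in sequentially. 4 * \<kappa> * \<epsilon> j < 1 \<and> bound (\<epsilon> j) < e"
      by (auto simp: eventually_conj_iff)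
    \<comment> \<open>The index is fixed first; then every volume below that of the ball of radius
      \<open>\<epsilon> j\<close> is admissible.\<close>
    then obtain j where j: "4 * \<kappa> * \<epsilon> j < 1" "bound (\<epsilon> j) < e"
      by (auto simp: eventually_sequentially)
    have "0 < unit_vol TYPE('a) * \<epsilon> j ^ DIM('a)" by (simp add: unit_vol_pos \<epsilon>_pos)
    then show "\<forall>\<^sub>F v in at_right 0. dist (M t v) 0 < e"
    proof (rule eventually_at_rightI[rotated])
      fix v assume "v \<in> {0<..<unit_vol TYPE('a) * \<epsilon> j ^ DIM('a)}"
      then show "dist (M t v) 0 < e" using M_bound[of j v] j by auto
    qed
  qed
qed

end
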